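(* Let $1<p<\infty$, let $\{w_n\}_{n=1}^\infty$ be a sequence of positive numbers, and let $T$ be the bilateral weighted shift on $\ell^p(\mathbb{Z})$ given by $$Te_0=e_1,\qquad Te_n=w_ne_{n+1}\ (n\ge1),\qquad Te_{-n}=w_ne_{-n+1}\ (n\ge 1).$$ If there is a positive integer $m_0$ such that $$\frac{1}{n+2m_0}\le w_{n+m_0}\le\frac1n\qquad\text{for all } n\ge 1,$$ then $\Lambda(T)=[\tfrac12,1]$.
   Context: $\ell^p(\mathbb{Z})$ is the complex Banach space of two-sided $p$-summable complex sequences, with canonical basis $\{e_n\}_{n\in\mathbb{Z}}$. A bounded operator $T$ on a complex Banach space $X$ is quasinilpotent if its spectrum is $\{0\}$ (the operator $T$ in the claim is quasinilpotent). For quasinilpotent $T$ and $x\in X\setminus\{0\}$, $$k_x=k_{(T,x)}=\limsup_{z\to 0}\frac{\ln\|(z-T)^{-1}x\|}{\ln\|(z-T)^{-1}\|}$$ ($z\in\mathbb{C}\setminus\{0\}$), and the power set of $T$ is $\Lambda(T)=\{k_x: x\in X\setminus\{0\}\}$. *)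

theory Defs
  imports "HOL-Analysis.Analysis"
begin

text \<open>
  The exponent is a term, so the sequence spaces are carrier sets inside
  \<^typ>\<open>int \<Rightarrow> complex\<close>. Operators are total functions on that type, of which only the values on
  the carrier matter.
\<close>

definition lp :: "real \<Rightarrow> (int \<Rightarrow> complex) set" where
  "lp p = {x. (\<lambda>n. cmod (x n) powr p) summable_on UNIV}"

definition lp_norm :: "real \<Rightarrow> (int \<Rightarrow> complex) \<Rightarrow> real" where
  "lp_norm p x = (\<Sum>\<^sub>\<infinity>n. cmod (x n) powr p) powr (1 / p)"

definition lp_basis :: "int \<Rightarrow> int \<Rightarrow> complex" where
  "lp_basis n = (\<lambda>k. if k = n then 1 else 0)"

definition lp_bounded_operator :: "real \<Rightarrow> ((int \<Rightarrow> complex) \<Rightarrow> int \<Rightarrow> complex) \<Rightarrow> bool" where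
  "lp_bounded_operator p T \<longleftrightarrow>
     T \<in> lp p \<rightarrow> lp p \<and>
     (\<forall>x\<in>lp p. \<forall>y\<in>lp p. T (\<lambda>k. x k + y k) = (\<lambda>k. T x k + T y k)) \<and>
     (\<forall>c. \<forall>x\<in>lp p. T (\<lambda>k. c * x k) = (\<lambda>k. c * T x k)) \<and>
     (\<exists>C. \<forall>x\<in>lp p. lp_norm p (T x) \<le> C * lp_norm p x)"

definition lp_opnorm :: "real \<Rightarrow> ((int \<Rightarrow> complex) \<Rightarrow> int \<Rightarrow> complex) \<Rightarrow> real" where
  "lp_opnorm p S = (SUP x\<in>{x\<in>lp p. lp_norm p x \<le> 1}. lp_norm p (S x))"

text \<open>
  The inverse of \<open>z - T\<close> as a map of the space to itself; meaningful for \<open>z\<close> outside the spectrum,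
  hence for every \<open>z \<noteq> 0\<close> when \<open>T\<close> is quasinilpotent.
\<close>

definition lp_resolvent ::
    "real \<Rightarrow> ((int \<Rightarrow> complex) \<Rightarrow> int \<Rightarrow> complex) \<Rightarrow> complex \<Rightarrow> (int \<Rightarrow> complex) \<Rightarrow> int \<Rightarrow> complex" where
  "lp_resolvent p T z = the_inv_into (lp p) (\<lambda>x k. z * x k - T x k)"

text \<open>The upper limit is taken in the extended reals, over the punctured neighbourhoods of 0.\<close>

definition power_index ::
    "real \<Rightarrow> ((int \<Rightarrow> complex) \<Rightarrow> int \<Rightarrow> complex) \<Rightarrow> (int \<Rightarrow> complex) \<Rightarrow> ereal" where
  "power_index p T x =
     Limsup (at 0) (\<lambda>z. ereal (ln (lp_norm p (lp_resolvent p T z x)) /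
                               ln (lp_opnorm p (lp_resolvent p T z))))"

definition power_set :: "real \<Rightarrow> ((int \<Rightarrow> complex) \<Rightarrow> int \<Rightarrow> complex) \<Rightarrow> ereal set" where
  "power_set p T = power_index p T ` (lp p - {\<lambda>k. 0})"

end

theory Submission
  imports Defs "HOL-Complex_Analysis.Complex_Analysis"
begin

text \<open>
  On the logarithmic scale near \<open>z = 0\<close>, put \<open>r = 1 / \<bar>z\<bar>\<close>. The weights are asymptotic to \<open>1 / n\<close> in both
  directions, and all the estimates come from this. By the Neumann series, the basis vector at \<open>j\<close> contributes
  to coordinate \<open>j + k\<close> of the resolvent the number \<open>r ^ (k + 1)\<close> (in modulus) times the product of the
  \<open>k\<close> weights met on the way from \<open>j\<close> to \<open>j + k\<close>. For \<open>j = - n\<close> and \<open>j + k = m\<close> with \<open>n, m \<ge> 0\<close> the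
  product is about \<open>1 / (n! m!)\<close>, and away from 0 it is at most about \<open>1 / k!\<close>.

  Hence the norm of the resolvent grows like \<open>\<Sum>k. (2 r) ^ k / k! = exp (2 r)\<close>, by the binomial theorem
  for the upper bound (\<open>weight_prod_le\<close>, \<open>resolvent_series_norm_le\<close>) and by the best choice of \<open>n\<close> and
  \<open>m\<close> for the lower one (\<open>large_coefficient\<close>). The power index of a vector \<open>x\<close> is therefore half the
  upper exponential rate, in \<open>r\<close>, of the resolvent at \<open>x\<close>.

  This rate is at most 2. It is at least 1: if \<open>x j \<noteq> 0\<close>, then Cauchy's estimate in the variable
  \<open>1 / z\<close> isolates the contribution of \<open>x j\<close> to a coordinate on the right, of size about
  \<open>r ^ k / k!\<close>, at some point of each circle; the best \<open>k\<close> gives \<open>exp r\<close> (\<open>power_index_ge_half\<close>). For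
  \<open>0 \<le> g \<le> 1\<close>, a vector on the negative axis that decays like \<open>g ^ n\<close> has the rate \<open>1 + g\<close>: the right
  half of the weights contributes \<open>exp r\<close> as before, and the left half contributes
  \<open>\<Sum>n. (g r) ^ n / n! = exp (g r)\<close> (\<open>power_index_geometric_tail\<close>). So the indices fill the interval from
  1/2 to 1.

  Factors that are subexponential in \<open>r\<close> are lost freely throughout. This is organised by a parameter
  \<open>lam > 1\<close> that multiplies or divides a rate and is arbitrarily close to 1.
\<close>

section \<open>Sequence spaces\<close>

lemma lp_norm_nonneg: "0 \<le> lp_norm p x"
  unfolding lp_norm_def by simp

lemma lp_norm_powr:
  assumes "p > 0"
  shows "lp_norm p x powr p = (\<Sum>\<^sub>\<infinity>n. cmod (x n) powr p)"
  using assms by (simp add: lp_norm_def powr_powr infsum_nonneg)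

lemma lp_normI:
  assumes p: "p > 0" and B: "B \<ge> 0"
    and le: "\<And>M. finite M \<Longrightarrow> (\<Sum>m\<in>M. cmod (y m) powr p) \<le> B powr p"
  shows "y \<in> lp p" and "lp_norm p y \<le> B"
proof -
  have s: "(\<lambda>n. cmod (y n) powr p) summable_on UNIV"
    by (rule nonneg_bdd_above_summable_on) (auto simp: bdd_above_def intro!: exI le)
  then show "y \<in> lp p" by (simp add: lp_def)
  have "(\<Sum>\<^sub>\<infinity>n. cmod (y n) powr p) \<le> B powr p"
    using s le by (intro infsum_le_finite_sums) auto
  then have "lp_norm p y \<le> (B powr p) powr (1 / p)"
    unfolding lp_norm_def using p by (intro powr_mono2 infsum_nonneg) auto
  then show "lp_norm p y \<le> B" using p B by (simp add: powr_powr)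
qed

lemma sum_powr_le_lp_norm:
  assumes "p > 0" "x \<in> lp p" "finite M"
  shows "(\<Sum>m\<in>M. cmod (x m) powr p) \<le> lp_norm p x powr p"
  using assms by (auto simp: lp_norm_powr lp_def intro!: finite_sum_le_infsum)

lemma norm_le_lp_norm:
  assumes "p > 0" "x \<in> lp p"
  shows "cmod (x m) \<le> lp_norm p x"
proof -
  have "cmod (x m) powr p \<le> lp_norm p x powr p"
    using sum_powr_le_lp_norm[OF assms, of "{m}"] by simp
  then show ?thesis using assms(1) lp_norm_nonneg[of p x]
    by (metis norm_ge_zero not_le powr_less_mono2)
qed

lemma lp_norm_pos:
  assumes "p > 0" "x \<in> lp p" "x \<noteq> (\<lambda>_. 0)"
  shows "0 < lp_norm p x"
proof -
  obtain m where "x m \<noteq> 0" using assms(3) by auto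
  then show ?thesis using norm_le_lp_norm[OF assms(1,2), of m]
    by (meson less_le_trans zero_less_norm_iff)
qed

lemma lp_scale: "x \<in> lp p \<Longrightarrow> (\<lambda>k. c * x k) \<in> lp p"
  by (auto simp: lp_def norm_mult powr_mult intro: summable_on_cmult_right)

lemma lp_basis_lp:
  assumes "p > 0"
  shows "lp_basis n \<in> lp p" "lp_norm p (lp_basis n) \<le> 1"
proof -
  have "(\<Sum>m\<in>M. cmod (lp_basis n m) powr p) \<le> 1 powr p" if "finite M" for M
  proof -
    have "(\<Sum>m\<in>M. cmod (lp_basis n m) powr p) = (\<Sum>m\<in>M. if n = m then 1 else 0)"
      by (rule sum.cong) (auto simp: lp_basis_def)
    then show ?thesis using that by simp
  qed
  then show "lp_basis n \<in> lp p" "lp_norm p (lp_basis n) \<le> 1"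
    using lp_normI[of p 1] assms by auto
qed

text \<open>
  A form of Young's inequality \<open>\<parallel>d * x\<parallel>\<^sub>p \<le> \<parallel>d\<parallel>\<^sub>1 \<parallel>x\<parallel>\<^sub>p\<close> with a constant. The geometric weights
  \<open>1 / lam ^ k\<close> bound the inner sum by a multiple of the supremum of \<open>d k * cmod (x (m - k))\<close>, hence of its
  \<open>p\<close>-norm in \<open>k\<close>, and then the sums over \<open>k\<close> and \<open>m\<close> can be exchanged. The constant is harmless
  below, because growth is measured on a logarithmic scale.
\<close>

lemma lp_convolution_bound:
  assumes p: "p \<ge> 1" and lam: "lam > 1" and d: "\<And>k. d k \<ge> 0" "d sums D"
    and x: "x \<in> lp p"
    and le: "\<And>m. cmod (y m) \<le> (\<Sum>k. (d k / lam ^ k) * cmod (x (m - int k)))"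
  shows "y \<in> lp p" and "lp_norm p y \<le> lam / (lam - 1) * D * lp_norm p x"
proof -
  have p0: "p > 0" using p by simp
  define K where "K = lam / (lam - 1)"
  have K0: "K > 0" using lam by (simp add: K_def)
  have geo: "(\<lambda>k. (1 / lam) ^ k) sums K"
    using geometric_sums[of "1 / lam"] lam by (simp add: K_def field_simps)
  have sd: "summable d" using d(2) by (simp add: sums_iff)
  have dD: "d k \<le> D" for k
    using sum_le_suminf[OF sd, of "{k}"] d by (simp add: sums_iff)
  have D0: "D \<ge> 0" using dD[of 0] d(1)[of 0] by linarith
  have dp: "d k powr p \<le> D powr (p - 1) * d k" for k
  proof (cases "d k = 0")
    case False
    then have pos: "d k > 0" using d(1)[of k] by linarith
    have "d k powr p = d k powr (p - 1) * d k"
      using pos by (simp add: powr_diff)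
    also have "\<dots> \<le> D powr (p - 1) * d k"
      using dD[of k] p pos by (intro mult_right_mono powr_mono2) auto
    finally show ?thesis .
  qed (use p0 in auto)
  have sdp: "summable (\<lambda>k. d k powr p)"
    by (rule summable_comparison_test_ev[OF _ summable_mult[OF sd, of "D powr (p - 1)"]])
       (use dp in auto)
  have sumdp: "(\<Sum>k. d k powr p) \<le> D powr p"
  proof -
    have "(\<Sum>k. d k powr p) \<le> (\<Sum>k. D powr (p - 1) * d k)"
      by (intro suminf_le dp sdp summable_mult sd)
    also have "\<dots> = D powr (p - 1) * D" using d(2) sd by (simp add: suminf_mult sums_iff)
    also have "\<dots> = D powr p" using D0 p0 by (cases "D = 0") (auto simp: powr_diff)
    finally show ?thesis .
  qed
  define b where "b m k = d k powr p * cmod (x (m - int k)) powr p" for m k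
  have b0: "b m k \<ge> 0" for m k by (simp add: b_def)
  have xb: "cmod (x j) powr p \<le> lp_norm p x powr p" for j
    using sum_powr_le_lp_norm[OF p0 x, of "{j}"] by simp
  have sb: "summable (b m)" for m
    by (rule summable_comparison_test_ev[OF _ summable_mult2[OF sdp, of "lp_norm p x powr p"]])
       (auto simp: b_def intro!: always_eventually mult_left_mono xb)
  have ym: "cmod (y m) powr p \<le> K powr p * (\<Sum>k. b m k)" for m
  proof -
    define S where "S = (\<Sum>k. b m k)"
    have S0: "S \<ge> 0" unfolding S_def by (intro suminf_nonneg sb b0)
    have tm: "(d k / lam ^ k) * cmod (x (m - int k)) \<le> (1 / lam) ^ k * S powr (1 / p)" for k
    proof -
      have "b m k \<le> S" using sum_le_suminf[OF sb, of "{k}" m] b0 by (simp add: S_def)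
      then have "b m k powr (1 / p) \<le> S powr (1 / p)"
        using p0 b0 by (intro powr_mono2) auto
      then have "d k * cmod (x (m - int k)) \<le> S powr (1 / p)"
        using p0 d(1)[of k] by (simp add: b_def powr_mult powr_powr)
      then have "d k * cmod (x (m - int k)) / lam ^ k \<le> S powr (1 / p) / lam ^ k"
        using lam by (intro divide_right_mono) auto
      then show ?thesis by (simp add: power_divide)
    qed
    have rs: "(\<lambda>k. (1 / lam) ^ k * S powr (1 / p)) sums (K * S powr (1 / p))"
      by (intro sums_mult2 geo)
    have ls: "summable (\<lambda>k. (d k / lam ^ k) * cmod (x (m - int k)))"
      by (rule summable_comparison_test_ev[OF _ sums_summable[OF rs]])
         (use tm d(1) lam in \<open>auto simp: abs_mult\<close>)
    have "cmod (y m) \<le> K * S powr (1 / p)"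
      using le[of m] suminf_le[OF tm ls sums_summable[OF rs]] rs by (simp add: sums_iff)
    then have "cmod (y m) powr p \<le> (K * S powr (1 / p)) powr p"
      using p0 by (intro powr_mono2) auto
    also have "\<dots> = K powr p * S" using p0 S0 by (simp add: powr_mult powr_powr)
    finally show ?thesis by (simp add: S_def)
  qed
  have fin: "(\<Sum>m\<in>M. cmod (y m) powr p) \<le> (K * D * lp_norm p x) powr p" if M: "finite M" for M
  proof -
    have "(\<Sum>m\<in>M. cmod (y m) powr p) \<le> K powr p * (\<Sum>m\<in>M. \<Sum>k. b m k)"
      unfolding sum_distrib_left by (intro sum_mono ym)
    also have "(\<Sum>m\<in>M. \<Sum>k. b m k) = (\<Sum>k. \<Sum>m\<in>M. b m k)"
      by (intro suminf_sum[symmetric] sb)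
    also have "\<dots> \<le> (\<Sum>k. d k powr p * lp_norm p x powr p)"
    proof (intro suminf_le summable_sum sb summable_mult2 sdp)
      fix k
      have "(\<Sum>m\<in>M. cmod (x (m - int k)) powr p)
          = (\<Sum>j\<in>(\<lambda>m. m - int k) ` M. cmod (x j) powr p)"
        by (subst sum.reindex) (auto simp: inj_on_def)
      also have "\<dots> \<le> lp_norm p x powr p" using M by (intro sum_powr_le_lp_norm p0 x) auto
      finally show "(\<Sum>m\<in>M. b m k) \<le> d k powr p * lp_norm p x powr p"
        by (auto simp: b_def sum_distrib_left[symmetric] intro: mult_left_mono)
    qed
    also have "\<dots> = (\<Sum>k. d k powr p) * lp_norm p x powr p" by (intro suminf_mult2[symmetric] sdp)
    also have "\<dots> \<le> D powr p * lp_norm p x powr p"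
      by (intro mult_right_mono sumdp) auto
    finally show ?thesis using K0 D0 lp_norm_nonneg[of p x]
      by (simp add: powr_mult mult.assoc mult_left_mono)
  qed
  show "y \<in> lp p" "lp_norm p y \<le> lam / (lam - 1) * D * lp_norm p x"
    using lp_normI[OF p0 _ fin] K0 D0 lp_norm_nonneg[of p x] by (simp_all flip: K_def)
qed

section \<open>Products of approximate reciprocals and the exponential series\<close>

text \<open>
  Up to a factor \<open>lam\<close>, \<open>b (l + i)\<close> is at most \<open>1 / (l + i)\<close> and so at most \<open>1 / i\<close>, with finitely
  many exceptions, each of which a window meets at most once. So one constant serves for all windows
  of \<open>k\<close> consecutive weights, wherever they start.
\<close>

lemma window_prod_le:
  assumes pos: "\<And>n. n \<ge> 1 \<Longrightarrow> b n > (0::real)" and lim: "(\<lambda>n. real n * b n) \<longlonglongrightarrow> 1"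
    and lam: "lam > 1"
  shows "\<exists>C\<ge>1. \<forall>l k. (\<Prod>i=1..k. b (l + i)) \<le> C * lam ^ k / fact k"
proof -
  obtain N where N: "\<And>n. n \<ge> N \<Longrightarrow> real n * b n < lam"
    using order_tendstoD(2)[OF lim lam] by (auto simp: eventually_sequentially)
  define D where "D n = (if n < N then max 1 (real n * b n) else 1)" for n
  have D1: "D n \<ge> 1" for n by (auto simp: D_def)
  have bD: "real n * b n \<le> lam * D n" for n
    using N[of n] lam D1[of n] mult_mono[of 1 lam "real n * b n" "D n"] 
    by (auto simp: D_def intro: order.trans[OF _ mult_right_mono[of 1 lam]])
  have "(\<Prod>i=1..k. b (l + i)) \<le> (\<Prod>n<N. D n) * lam ^ k / fact k" for l k
  proof -
    have "fact k * (\<Prod>i=1..k. b (l + i)) = (\<Prod>i=1..k. real i * b (l + i))"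
      by (simp add: fact_prod prod.distrib)
    also have "\<dots> \<le> (\<Prod>i=1..k. lam * D (l + i))"
    proof (intro prod_mono conjI)
      fix i assume i: "i \<in> {1..k}"
      then show "0 \<le> real i * b (l + i)" using pos[of "l + i"] by auto
      have "real i * b (l + i) \<le> real (l + i) * b (l + i)"
        using i pos[of "l + i"] by (intro mult_right_mono) auto
      then show "real i * b (l + i) \<le> lam * D (l + i)" using bD[of "l + i"] by linarith
    qed
    also have "\<dots> = lam ^ k * (\<Prod>i=1..k. D (l + i))" by (simp add: prod.distrib)
    also have "(\<Prod>i=1..k. D (l + i)) = (\<Prod>n\<in>{l+1..l+k}. D n)"
      by (rule prod.reindex_bij_witness[of _ "\<lambda>n. n - l" "\<lambda>i. l + i"]) auto
    also have "\<dots> = (\<Prod>n\<in>{l+1..l+k} \<inter> {..<N}. D n)"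
      by (intro prod.mono_neutral_right) (auto simp: D_def)
    also have "\<dots> \<le> (\<Prod>n<N. D n)"
      by (intro prod_mono2) (use D1 order.trans[OF zero_le_one D1] in auto)
    finally have "fact k * (\<Prod>i=1..k. b (l + i)) \<le> lam ^ k * (\<Prod>n<N. D n)"
      using lam by (simp add: mult_left_mono)
    then show ?thesis by (simp add: field_simps)
  qed
  moreover have "(\<Prod>n<N. D n) \<ge> 1" using D1 by (intro prod_ge_1) auto
  ultimately show ?thesis by blast
qed

text \<open>
  The upper bound applied to \<open>1 / (n\<^sup>2 * b n)\<close>, which is again asymptotic to \<open>1 / n\<close>, becomes a lower
  bound for \<open>b\<close>.
\<close>

lemma initial_prod_ge:
  assumes pos: "\<And>n. n \<ge> 1 \<Longrightarrow> b n > (0::real)" and lim: "(\<lambda>n. real n * b n) \<longlonglongrightarrow> 1"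
    and lam: "lam > 1"
  shows "\<exists>c>0. \<forall>k. c * (1 / lam) ^ k / fact k \<le> (\<Prod>i=1..k. b i)"
proof -
  define b' where "b' n = 1 / (real n ^ 2 * b n)" for n
  have "(\<lambda>n. inverse (real n * b n)) \<longlonglongrightarrow> inverse 1" by (intro tendsto_inverse lim) simp
  moreover have "\<forall>\<^sub>F n in sequentially. inverse (real n * b n) = real n * b' n"
    using eventually_gt_at_top[of 0] by eventually_elim (auto simp: b'_def power2_eq_square field_simps)
  ultimately have lim': "(\<lambda>n. real n * b' n) \<longlonglongrightarrow> 1"
    by (auto intro: Lim_transform_eventually)
  have "b' n > 0" if "n \<ge> 1" for n using that pos[of n] by (simp add: b'_def)
  from window_prod_le[OF this lim' lam] obtain C where C: "C \<ge> 1"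
    and le: "\<And>l k. (\<Prod>i=1..k. b' (l + i)) \<le> C * lam ^ k / fact k" by auto
  have "1 / C * (1 / lam) ^ k / fact k \<le> (\<Prod>i=1..k. b i)" for k
  proof -
    define P where "P = (\<Prod>i=1..k. b i)"
    have P: "P > 0" unfolding P_def by (intro prod_pos) (auto intro: pos)
    have "(\<Prod>i=1..k. b' i) = 1 / (fact k ^ 2 * P)"
      by (simp add: b'_def fact_prod P_def prod_dividef prod.distrib prod_power_distrib)
    with le[where l=0 and k=k] have "1 / (fact k ^ 2 * P) \<le> C * lam ^ k / fact k" by simp
    then show ?thesis unfolding P_def[symmetric] using P C lam
      by (simp add: field_simps power2_eq_square)
  qed
  then show ?thesis using C by (intro exI[of _ "1 / C"]) auto
qed

text \<open>
  A single term of the exponential series almost carries its sum, on the logarithmic scale, so that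
  single coordinates suffice for lower bounds. The series of \<open>exp (s / lam)\<close> has the terms
  \<open>s ^ m / fact m\<close> with geometric weights; if these terms were all small, so would be the sum.
\<close>

lemma exp_series_large_term:
  fixes s lam :: real
  assumes s: "s \<ge> 0" and lam: "lam > 1"
  shows "\<exists>m. (1 - 1 / lam) * exp (s / lam) \<le> s ^ m / fact m"
proof (rule ccontr)
  assume "\<not> ?thesis"
  then have less: "s ^ m / fact m < (1 - 1 / lam) * exp (s / lam)" for m by (simp add: not_le)
  have e: "(\<lambda>m. (1 / lam) ^ m * (s ^ m / fact m)) sums exp (s / lam)"
    using exp_converges[of "s / lam"] by (simp add: power_divide field_simps)
  have g: "(\<lambda>m. (1 / lam) ^ m * ((1 - 1 / lam) * exp (s / lam))) sums
      (1 / (1 - 1 / lam) * ((1 - 1 / lam) * exp (s / lam)))"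
    by (intro sums_mult2 geometric_sums) (use lam in auto)
  have "1 / (1 - 1 / lam) * ((1 - 1 / lam) * exp (s / lam)) = exp (s / lam)"
    using lam by simp
  with g have g': "(\<lambda>m. (1 / lam) ^ m * ((1 - 1 / lam) * exp (s / lam))) sums exp (s / lam)"
    by simp
  have "(\<Sum>m. (1 / lam) ^ m * ((1 - 1 / lam) * exp (s / lam)) - (1 / lam) ^ m * (s ^ m / fact m)) > 0"
  proof (intro suminf_pos sums_summable[OF sums_diff[OF g' e]])
    fix m
    have "(1 / lam) ^ m * (s ^ m / fact m) < (1 / lam) ^ m * ((1 - 1 / lam) * exp (s / lam))"
      using less[of m] lam by (intro mult_strict_left_mono) auto
    then show "0 < (1 / lam) ^ m * ((1 - 1 / lam) * exp (s / lam)) - (1 / lam) ^ m * (s ^ m / fact m)"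
      by linarith
  qed
  then show False using sums_diff[OF g' e] by (simp add: sums_iff)
qed

section \<open>Coefficients of entire power series\<close>

text \<open>
  Cauchy's estimate. Halving the bound avoids the question whether the supremum on the circle is
  attained.
\<close>

lemma coefficient_bounded_on_circle:
  fixes d :: "nat \<Rightarrow> complex"
  assumes sm: "\<And>u. summable (\<lambda>k. d k * u ^ k)" and r: "r > 0" and nz: "d n \<noteq> 0"
  shows "\<exists>u. cmod u = r \<and> cmod (d n) * r ^ n / 2 \<le> cmod (\<Sum>k. d k * u ^ k)"
proof (rule ccontr)
  assume "\<not> ?thesis"
  then have less: "cmod (\<Sum>k. d k * u ^ k) \<le> cmod (d n) * r ^ n / 2" if "cmod u = r" for u
    using that by force
  define F where "F = Abs_fps d"
  have ev: "eval_fps F u = (\<Sum>k. d k * u ^ k)" for u by (simp add: F_def eval_fps_def)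
  have rad: "fps_conv_radius F = \<infinity>"
    unfolding F_def fps_conv_radius_def using sm by (intro conv_radius_inftyI'') (auto)
  have hol: "eval_fps F holomorphic_on UNIV"
    by (rule holomorphic_on_eval_fps) (auto simp: rad)
  have "fps_nth F n = (deriv ^^ n) (eval_fps F) 0 / fact n"
    by (rule fps_nth_conv_deriv) (simp add: rad)
  moreover have "cmod ((deriv ^^ n) (eval_fps F) 0) \<le> fact n * (cmod (d n) * r ^ n / 2) / r ^ n"
  proof (intro Cauchy_inequality r)
    show "eval_fps F holomorphic_on ball 0 r" "continuous_on (cball 0 r) (eval_fps F)"
      using hol by (auto intro: holomorphic_on_subset holomorphic_on_imp_continuous_on)
    show "cmod (eval_fps F u) \<le> cmod (d n) * r ^ n / 2" if "cmod (0 - u) = r" for u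
      using less[of u] that by (simp add: ev)
  qed
  ultimately have "cmod (d n) \<le> cmod (d n) / 2"
    using r by (simp add: F_def norm_divide divide_le_eq mult.commute)
  then show False using nz by simp
qed

section \<open>Weights asymptotic to the reciprocals in both directions\<close>

lemma tendsto_reciprocal_shift:
  fixes f :: "int \<Rightarrow> real"
  assumes "(\<lambda>n. real n * f (int n)) \<longlonglongrightarrow> 1"
  shows "(\<lambda>n. real n * f (j + int n)) \<longlonglongrightarrow> 1"
proof -
  have "filterlim (\<lambda>n. nat (j + int n)) at_top sequentially"
    unfolding filterlim_at_top eventually_sequentially
  proof
    fix Z
    show "\<exists>N. \<forall>n\<ge>N. Z \<le> nat (j + int n)" by (intro exI[of _ "nat (int Z - j)"]) auto
  qed
  from filterlim_compose[OF assms this]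
  have 1: "(\<lambda>n. real (nat (j + int n)) * f (int (nat (j + int n)))) \<longlonglongrightarrow> 1" .
  have 2: "(\<lambda>n. real n / (real_of_int j + real n)) \<longlonglongrightarrow> 1"
    by real_asymp
  have "(\<lambda>n. real n / (real_of_int j + real n)
      * (real (nat (j + int n)) * f (int (nat (j + int n))))) \<longlonglongrightarrow> 1"
    using tendsto_mult[OF 2 1] by simp
  moreover have "\<forall>\<^sub>F n in sequentially. real n / (real_of_int j + real n)
      * (real (nat (j + int n)) * f (int (nat (j + int n)))) = real n * f (j + int n)"
    using eventually_gt_at_top[of "nat (- j)"]
  proof eventually_elim
    case (elim n)
    then have "j + int n > 0" by linarith
    moreover from this have "real_of_int j + real n > 0" by linarith
    ultimately show ?case by simp
  qed
  ultimately show ?thesis by (rule Lim_transform_eventually)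
qed

text \<open>
  The weights of the shift on all of \<open>\<int>\<close>, where \<open>a j\<close> leads from \<open>j\<close> to \<open>j + 1\<close>. The growth of the
  resolvent is determined by their being asymptotic to \<open>1 / \<bar>n\<bar>\<close> in both directions.
\<close>

locale reciprocal_weights =
  fixes a :: "int \<Rightarrow> real"
  assumes pos: "\<And>j. a j > 0"
    and right: "(\<lambda>n. real n * a (int n)) \<longlonglongrightarrow> 1"
    and left: "(\<lambda>n. real n * a (- int n)) \<longlonglongrightarrow> 1"
begin

text \<open>
  The shift raised to the power \<open>k\<close> maps the basis vector at \<open>j\<close> to \<open>weight_prod j k\<close> times the one
  at \<open>j + k\<close>.
\<close>

definition weight_prod :: "int \<Rightarrow> nat \<Rightarrow> real" where
  "weight_prod j k = (\<Prod>i<k. a (j + int i))"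

lemma weight_prod_0 [simp]: "weight_prod j 0 = 1"
  by (simp add: weight_prod_def)

lemma weight_prod_Suc: "weight_prod j (Suc k) = weight_prod j k * a (j + int k)"
  by (simp add: weight_prod_def)

lemma weight_prod_pos: "weight_prod j k > 0"
  unfolding weight_prod_def by (intro prod_pos) (auto intro: pos)

lemma weight_prod_add: "weight_prod j (k + l) = weight_prod j k * weight_prod (j + int k) l"
  by (induction l) (simp_all add: weight_prod_Suc add.assoc)

text \<open>
  A window to the right of 0 is read from left to right, one that ends at most at 0 from right to
  left, so that in both cases the weights occur in the order in which they decay.
\<close>

lemma weight_prod_right:
  "weight_prod (j + int l) k = (\<Prod>i=1..k. a (j - 1 + int (l + i)))"
  unfolding weight_prod_def
  by (rule prod.reindex_bij_witness[of _ "\<lambda>i. i - 1" "\<lambda>i. i + 1"]) (auto simp: algebra_simps)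

lemma weight_prod_left:
  "weight_prod (- int (l + k)) k = (\<Prod>i=1..k. a (- int (l + i)))"
  unfolding weight_prod_def
  by (rule prod.reindex_bij_witness[of _ "\<lambda>i. k - i" "\<lambda>i. k - i"]) (auto simp: of_nat_diff algebra_simps)

text \<open>
  A window of length \<open>k\<close> on one side of 0 has product at most about \<open>1 / k!\<close>. One that starts at \<open>-n\<close> and
  crosses 0 splits into two of lengths \<open>n\<close> and \<open>m = k - n\<close>, with product about \<open>1 / (n! m!)\<close>. With
  the factor \<open>g ^ n\<close> this is \<open>1 / k!\<close> times the term \<open>(k choose n) * g ^ n\<close> of \<open>(1 + g) ^ k\<close>. This is
  where the exponential rate \<open>1 + g\<close> comes from.
\<close>

lemma weight_prod_le:
  assumes lam: "lam > 1" and g: "0 \<le> g" "g \<le> 1"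
  shows "\<exists>C>0. \<forall>j k. g ^ nat (- j) * weight_prod j k \<le> C * ((1 + g) * lam) ^ k / fact k"
proof -
  have r: "(\<lambda>n. real n * a (0 - 1 + int n)) \<longlonglongrightarrow> 1"
    using tendsto_reciprocal_shift[OF right, of "0 - 1"] .
  obtain C1 where C1: "C1 \<ge> 1"
      "\<And>l k. weight_prod (0 + int l) k \<le> C1 * lam ^ k / fact k"
    unfolding weight_prod_right using window_prod_le[OF _ r lam] pos by metis
  obtain C2 where C2: "C2 \<ge> 1"
      "\<And>l k. weight_prod (- int (l + k)) k \<le> C2 * lam ^ k / fact k"
    unfolding weight_prod_left using window_prod_le[OF _ left lam] pos by metis
  have C: "C1 \<le> C1 * C2" "C2 \<le> C1 * C2" using C1(1) C2(1) by auto
  have one_side: "g ^ nat (- j) * weight_prod j k \<le> C1 * C2 * ((1 + g) * lam) ^ k / fact k"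
    if "weight_prod j k \<le> B * lam ^ k / fact k" and B: "B \<le> C1 * C2" for j k B
  proof -
    have "g ^ nat (- j) * weight_prod j k \<le> 1 * weight_prod j k"
      using g weight_prod_pos[of j k] by (intro mult_right_mono power_le_one) auto
    also have "\<dots> \<le> B * lam ^ k / fact k" using that by simp
    also have "\<dots> \<le> C1 * C2 * ((1 + g) * lam) ^ k / fact k"
      using B g lam C1(1) C2(1)
      by (intro divide_right_mono mult_mono power_mono) auto
    finally show ?thesis .
  qed
  have "g ^ nat (- j) * weight_prod j k \<le> C1 * C2 * ((1 + g) * lam) ^ k / fact k" for j k
  proof -
    consider "j \<ge> 0" | "j < 0" "k \<le> nat (- j)" | "j < 0" "nat (- j) < k" by linarith
    then show ?thesis
    proof cases
      case 1
      then show ?thesis using C1(2)[of "nat j" k] C one_side[of j k C1] by simp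
    next
      case 2
      then show ?thesis using C2(2)[of "nat (- j) - k" k] C one_side[of j k C2] by simp
    next
      case 3
      define n where "n = nat (- j)"
      define m where "m = k - n"
      have k: "k = n + m" and j: "j = - int n" using 3 by (auto simp: n_def m_def)
      have "weight_prod j k = weight_prod (- int (0 + n)) n * weight_prod (0 + int 0) m"
        by (simp add: k j weight_prod_add)
      also have "\<dots> \<le> (C2 * lam ^ n / fact n) * (C1 * lam ^ m / fact m)"
        using weight_prod_pos C1(1) C2(1) lam
        by (intro mult_mono C1(2) C2(2)) (auto intro: less_imp_le)
      also have "\<dots> = C1 * C2 * lam ^ k * (1 / (fact n * fact m))"
        by (simp add: k power_add)
      finally have "g ^ nat (- j) * weight_prod j k
          \<le> g ^ n * (C1 * C2 * lam ^ k * (1 / (fact n * fact m)))"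
        unfolding n_def[symmetric] using g by (intro mult_left_mono) auto
      also have "\<dots> = C1 * C2 * lam ^ k / fact k * (real (k choose n) * g ^ n)"
        by (subst binomial_fact) (auto simp: k field_simps)
      also have "\<dots> \<le> C1 * C2 * lam ^ k / fact k * (1 + g) ^ k"
      proof (rule mult_left_mono)
        show "real (k choose n) * g ^ n \<le> (1 + g) ^ k"
          using member_le_sum[of n "{..k}" "\<lambda>i. real (k choose i) * g ^ i * 1 ^ (k - i)"] g k
            binomial_ring[of g 1 k] by (simp add: add.commute)
        show "0 \<le> C1 * C2 * lam ^ k / fact k" using C1(1) C2(1) lam by simp
      qed
      finally have "g ^ nat (- j) * weight_prod j k \<le> C1 * C2 * lam ^ k / fact k * (1 + g) ^ k" .
      then show ?thesis by (simp add: power_mult_distrib mult_ac)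
    qed
  qed
  then show ?thesis using C1(1) C2(1) by (intro exI[of _ "C1 * C2"]) auto
qed

lemma weight_prod_ge:
  assumes lam: "lam > 1"
  shows "\<exists>c>0. \<forall>k. c * (1 / lam) ^ k / fact k \<le> weight_prod j k"
proof -
  have r: "(\<lambda>n. real n * a (j - 1 + int n)) \<longlonglongrightarrow> 1"
    using tendsto_reciprocal_shift[OF right, of "j - 1"] .
  show ?thesis
    using initial_prod_ge[OF pos r lam] weight_prod_right[of j 0] by simp
qed

lemma weight_prod_to_0_ge:
  assumes lam: "lam > 1"
  shows "\<exists>c>0. \<forall>n. c * (1 / lam) ^ n / fact n \<le> weight_prod (- int n) n"
  using initial_prod_ge[OF pos left lam] weight_prod_left[of 0] by simp

text \<open>
  The lower counterpart of \<open>weight_prod_le\<close>. The product of a window from \<open>-n\<close> to \<open>m\<close> is about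
  \<open>1 / (n! m!)\<close>; choosing \<open>n\<close> and \<open>m\<close> such that \<open>(g r) ^ n / n!\<close> and \<open>r ^ m / m!\<close> are large terms of their
  exponential series gives about \<open>exp (g r) * exp r\<close>. The polynomial factor comes from the vectors
  to which the estimate will be applied.
\<close>

lemma large_coefficient:
  assumes lam: "lam > 1" and g: "0 \<le> g"
  shows "\<exists>c>0. \<forall>r>0. \<exists>n m. c * exp ((1 + g) * r / lam)
    \<le> g ^ n / (real n + 1) ^ 2 * r ^ (n + m) * weight_prod (- int n) (n + m)"
proof -
  \<comment> \<open>A factor \<open>mu\<close> is lost three times: in the weights, in the polynomial factor and in the choice of
    the largest terms.\<close>
  define mu where "mu = root 3 lam"
  have mu: "mu > 1" using lam by (simp add: mu_def)
  have mu3: "mu ^ 3 = lam" using lam by (simp add: mu_def)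
  obtain c1 where c1: "c1 > 0" "\<And>k. c1 * (1 / mu) ^ k / fact k \<le> weight_prod 0 k"
    using weight_prod_ge[OF mu] by blast
  obtain c2 where c2: "c2 > 0" "\<And>n. c2 * (1 / mu) ^ n / fact n \<le> weight_prod (- int n) n"
    using weight_prod_to_0_ge[OF mu] by blast
  have "(\<lambda>n. (real n + 1) ^ 2 / mu ^ n) \<longlonglongrightarrow> 0" using mu by real_asymp
  from BseqE[OF convergent_imp_Bseq[OF convergentI[OF this]]]
  obtain K where K: "K > 0" "\<And>n. norm ((real n + 1) ^ 2 / mu ^ n) \<le> K" by blast
  have K': "1 / (K * mu ^ n) \<le> 1 / (real n + 1) ^ 2" for n
    using K(2)[of n] K(1) mu by (intro divide_left_mono) (auto simp: divide_simps)
  define q where "q = 1 - 1 / mu"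
  have q: "q > 0" using mu by (simp add: q_def)
  have "\<exists>n m. c1 * c2 / K * q ^ 2 * exp ((1 + g) * r / lam)
    \<le> g ^ n / (real n + 1) ^ 2 * r ^ (n + m) * weight_prod (- int n) (n + m)" if r: "r > 0" for r
  proof -
    obtain n where n: "q * exp (g * r / mu ^ 2 / mu) \<le> (g * r / mu ^ 2) ^ n / fact n"
      using exp_series_large_term[of "g * r / mu ^ 2" mu] g r mu by (auto simp: q_def)
    obtain m where m: "q * exp (r / mu / mu) \<le> (r / mu) ^ m / fact m"
      using exp_series_large_term[of "r / mu" mu] r mu by (auto simp: q_def)
    have e: "exp (r / lam) \<le> exp (r / mu / mu)"
    proof -
      have "mu * mu \<le> lam"
        using mu mult_left_mono[of 1 mu "mu * mu"] by (simp add: mu3[symmetric] power3_eq_cube)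
      then show ?thesis using r mu lam by (simp add: frac_le)
    qed
    have "c1 * c2 / K * q ^ 2 * exp ((1 + g) * r / lam)
        = c1 * c2 / K * ((q * exp (g * r / mu ^ 2 / mu)) * (q * exp (r / lam)))"
      by (simp add: mu3[symmetric] power2_eq_square power3_eq_cube distrib_right add_divide_distrib
          exp_add)
    also have "\<dots> \<le> c1 * c2 / K * (((g * r / mu ^ 2) ^ n / fact n) * ((r / mu) ^ m / fact m))"
    proof (rule mult_left_mono[OF mult_mono[OF n]])
      show "q * exp (r / lam) \<le> (r / mu) ^ m / fact m"
        using mult_left_mono[OF e, of q] q m by linarith
      show "0 \<le> (g * r / mu ^ 2) ^ n / fact n" "0 \<le> q * exp (r / lam)" "0 \<le> c1 * c2 / K"
        using g r q c1(1) c2(1) K(1) by auto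
    qed
    also have "\<dots> = (g ^ n * (1 / (K * mu ^ n))) * r ^ (n + m) *
        ((c2 * (1 / mu) ^ n / fact n) * (c1 * (1 / mu) ^ m / fact m))"
      using mu by (simp add: power_mult_distrib power_divide power_add power2_eq_square field_simps)
    also have "\<dots> \<le> (g ^ n * (1 / (real n + 1) ^ 2)) * r ^ (n + m) *
        (weight_prod (- int n) n * weight_prod 0 m)"
    proof (rule mult_mono)
      show "g ^ n * (1 / (K * mu ^ n)) * r ^ (n + m) \<le> g ^ n * (1 / (real n + 1)\<^sup>2) * r ^ (n + m)"
        using g r by (intro mult_right_mono mult_left_mono K') auto
      show "c2 * (1 / mu) ^ n / fact n * (c1 * (1 / mu) ^ m / fact m)
          \<le> weight_prod (- int n) n * weight_prod 0 m"
      proof (rule mult_mono[OF c2(2) c1(2)])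
        show "0 \<le> weight_prod (- int n) n" by (rule less_imp_le[OF weight_prod_pos])
      qed (use c1(1) mu in auto)
    qed (use g r c1(1) c2(1) mu in auto)
    also have "\<dots> = g ^ n / (real n + 1) ^ 2 * r ^ (n + m) * weight_prod (- int n) (n + m)"
      by (simp add: weight_prod_add)
    finally show ?thesis by blast
  qed
  then show ?thesis using c1(1) c2(1) K(1) q
    by (intro exI[of _ "c1 * c2 / K * q ^ 2"]) (auto)
qed

section \<open>The resolvent of the shift\<close>

text \<open>
  The Neumann series of the resolvent, coordinate by coordinate. Each coordinate is an entire power
  series in \<open>1 / z\<close>.
\<close>

definition resolvent_series :: "complex \<Rightarrow> (int \<Rightarrow> complex) \<Rightarrow> int \<Rightarrow> complex" where
  "resolvent_series z x m =
     (\<Sum>k. x (m - int k) * of_real (weight_prod (m - int k) k) * (1 / z) ^ (k + 1))"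

lemma summable_norm_resolvent_series:
  assumes B: "\<And>j. cmod (x j) \<le> B"
  shows "summable (\<lambda>k. norm (x (m - int k) * of_real (weight_prod (m - int k) k) * u ^ k))"
proof -
  obtain C where C: "C > 0"
      "\<And>j k. 1 ^ nat (- j) * weight_prod j k \<le> C * ((1 + 1) * 2) ^ k / fact k"
    using weight_prod_le[of 2 1] by auto
  have le: "norm (x (m - int k) * of_real (weight_prod (m - int k) k) * u ^ k)
      \<le> B * C * ((4 * cmod u) ^ k / fact k)" for k
  proof -
    have "norm (x (m - int k) * of_real (weight_prod (m - int k) k) * u ^ k)
        = cmod (x (m - int k)) * weight_prod (m - int k) k * cmod u ^ k"
      using weight_prod_pos[of "m - int k" k] by (simp add: norm_mult norm_power)
    also have "\<dots> \<le> B * (C * 4 ^ k / fact k) * cmod u ^ k"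
      using B C(2)[of "m - int k" k] weight_prod_pos[of "m - int k" k] order.trans[OF norm_ge_zero B]
      by (intro mult_right_mono mult_mono) (auto intro: less_imp_le)
    also have "\<dots> = B * C * ((4 * cmod u) ^ k / fact k)" by (simp add: power_mult_distrib)
    finally show ?thesis .
  qed
  have "summable (\<lambda>k. B * C * ((4 * cmod u) ^ k / fact k))"
    using exp_converges[of "4 * cmod u"]
    by (intro summable_mult[of "\<lambda>k. (4 * cmod u) ^ k / fact k"])
       (simp add: sums_iff divide_inverse mult.commute)
  then show ?thesis
    by (rule summable_comparison_test_ev[OF always_eventually, rotated])
       (simp only: real_norm_def abs_norm_cancel le simp_thms)
qed

lemma resolvent_series_eq_power_series:
  assumes B: "\<And>j. cmod (x j) \<le> B"
  shows "resolvent_series z x m =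
    1 / z * (\<Sum>k. x (m - int k) * of_real (weight_prod (m - int k) k) * (1 / z) ^ k)"
proof -
  have "summable (\<lambda>k. x (m - int k) * of_real (weight_prod (m - int k) k) * (1 / z) ^ k)"
    by (rule summable_norm_cancel[OF summable_norm_resolvent_series[OF B]])
  then have "1 / z * (\<Sum>k. x (m - int k) * of_real (weight_prod (m - int k) k) * (1 / z) ^ k)
      = (\<Sum>k. 1 / z * (x (m - int k) * of_real (weight_prod (m - int k) k) * (1 / z) ^ k))"
    by (rule suminf_mult[symmetric])
  also have "\<dots> = resolvent_series z x m"
    unfolding resolvent_series_def by (intro suminf_cong) (simp only: power_add power_one_right mult_ac)
  finally show ?thesis ..
qed

lemma resolvent_series_solves:
  assumes B: "\<And>j. cmod (x j) \<le> B" and z: "z \<noteq> 0"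
  shows "z * resolvent_series z x m - of_real (a (m - 1)) * resolvent_series z x (m - 1) = x m"
proof -
  define f where "f k = x (m - int k) * of_real (weight_prod (m - int k) k) * (1 / z) ^ k" for k
  have s: "summable f" unfolding f_def
    by (rule summable_norm_cancel[OF summable_norm_resolvent_series[OF B]])
  define h where
    "h k = x (m - 1 - int k) * of_real (weight_prod (m - 1 - int k) k) * (1 / z) ^ k" for k
  have sh: "summable h" unfolding h_def
    by (rule summable_norm_cancel[OF summable_norm_resolvent_series[OF B]])
  have "of_real (a (m - 1)) / z * suminf h = (\<Sum>k. of_real (a (m - 1)) / z * h k)"
    by (intro suminf_mult[symmetric] sh)
  also have "\<dots> = (\<Sum>k. f (Suc k))"
    by (intro suminf_cong) (simp add: f_def h_def weight_prod_Suc algebra_simps)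
  also have "\<dots> = suminf f - f 0" by (rule suminf_split_head[OF s])
  finally have "of_real (a (m - 1)) / z * suminf h = suminf f - x m" by (simp add: f_def)
  moreover have "resolvent_series z x m = 1 / z * suminf f"
      "resolvent_series z x (m - 1) = 1 / z * suminf h"
    using resolvent_series_eq_power_series[OF B] by (auto simp: f_def[abs_def] h_def[abs_def])
  ultimately show ?thesis using z by simp
qed

text \<open>
  An eigensequence is determined by any of its values; going \<open>k\<close> steps back along it and forward
  again gives factors that decay like \<open>1 / k!\<close>. Hence a bounded one vanishes.
\<close>

lemma bounded_eigensequence_zero:
  assumes B: "\<And>j. cmod (d j) \<le> B" and z: "z \<noteq> 0"
    and eq: "\<And>m. z * d m = of_real (a (m - 1)) * d (m - 1)"
  shows "d m = 0"
proof -
  have it: "d (j + int k) = d j * of_real (weight_prod j k) * (1 / z) ^ k" for j k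
  proof (induction k)
    case (Suc k)
    have "d (j + int (Suc k)) = of_real (a (j + int k)) / z * d (j + int k)"
      using eq[of "j + int (Suc k)"] z by (simp add: field_simps)
    then show ?case by (simp add: Suc weight_prod_Suc)
  qed simp
  have "d m = d (m - int k) * of_real (weight_prod (m - int k) k) * (1 / z) ^ k" for k
    using it[of "m - int k" k] by simp
  moreover have "(\<lambda>k. d (m - int k) * of_real (weight_prod (m - int k) k) * (1 / z) ^ k) \<longlonglongrightarrow> 0"
    by (rule summable_LIMSEQ_zero[OF summable_norm_cancel[OF summable_norm_resolvent_series[OF B]]])
  ultimately have "(\<lambda>k::nat. d m) \<longlonglongrightarrow> 0" by simp
  then show ?thesis using LIMSEQ_const_iff by blast
qed

text \<open>
  For \<open>g = 1\<close> and \<open>x = x'\<close> this bounds the norm of the resolvent. A smaller \<open>g\<close> expresses geometric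
  decay of \<open>x\<close> in the negative direction, where paths through the large weights around 0 start, and
  this decay lowers the exponential rate.
\<close>

lemma resolvent_series_norm_le:
  assumes p: "p \<ge> 1" and lam: "lam > 1" and g: "0 \<le> g" "g \<le> 1"
  shows "\<exists>A>0. \<forall>x x' z. z \<noteq> 0 \<longrightarrow> x' \<in> lp p \<longrightarrow> (\<forall>j. cmod (x j) \<le> g ^ nat (- j) * cmod (x' j)) \<longrightarrow>
    resolvent_series z x \<in> lp p \<and>
    lp_norm p (resolvent_series z x) \<le> A / cmod z * exp ((1 + g) * lam / cmod z) * lp_norm p x'"
proof -
  \<comment> \<open>One factor \<open>mu\<close> is lost in the weights and one in the convolution bound.\<close>
  define mu where "mu = sqrt lam"
  have mu: "mu > 1" "mu * mu = lam" using lam by (auto simp: mu_def)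
  obtain C where C: "C > 0"
      "\<And>j k. g ^ nat (- j) * weight_prod j k \<le> C * ((1 + g) * mu) ^ k / fact k"
    using weight_prod_le[OF mu(1) g] by auto
  have main: "resolvent_series z x \<in> lp p \<and> lp_norm p (resolvent_series z x)
      \<le> mu / (mu - 1) * C / cmod z * exp ((1 + g) * lam / cmod z) * lp_norm p x'"
    if z: "z \<noteq> 0" and x': "x' \<in> lp p" and le: "\<And>j. cmod (x j) \<le> g ^ nat (- j) * cmod (x' j)"
    for x x' z
  proof -
    define s where "s = (1 + g) * lam / cmod z"
    define d where "d k = C / cmod z * (s ^ k / fact k)" for k
    have s0: "s \<ge> 0" using g lam by (simp add: s_def)
    have d0: "d k \<ge> 0" for k using C s0 by (simp add: d_def)
    have "(\<lambda>k. s ^ k / fact k) sums exp s"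
      using exp_converges[of s] by (simp add: field_simps)
    then have ds: "d sums (C / cmod z * exp s)" unfolding d_def by (rule sums_mult)
    have x'B: "cmod (x' j) \<le> lp_norm p x'" for j using norm_le_lp_norm[of p x'] p x' by simp
    have xB: "cmod (x j) \<le> lp_norm p x'" for j
    proof -
      have "g ^ nat (- j) * cmod (x' j) \<le> 1 * cmod (x' j)"
        using g by (intro mult_right_mono power_le_one) auto
      then show ?thesis using le[of j] x'B[of j] by linarith
    qed
    have trm: "norm (x (m - int k) * of_real (weight_prod (m - int k) k) * (1 / z) ^ (k + 1))
        \<le> d k / mu ^ k * cmod (x' (m - int k))" for m k
    proof -
      let ?j = "m - int k"
      have "norm (x ?j * of_real (weight_prod ?j k) * (1 / z) ^ (k + 1))
          = cmod (x ?j) * (weight_prod ?j k * (1 / cmod z) ^ (k + 1))"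
        using weight_prod_pos[of ?j k] by (simp add: norm_mult norm_power norm_divide)
      also have "\<dots> \<le> (g ^ nat (- ?j) * cmod (x' ?j)) * (weight_prod ?j k * (1 / cmod z) ^ (k + 1))"
        using weight_prod_pos[of ?j k] by (intro mult_right_mono le mult_nonneg_nonneg) auto
      also have "\<dots> = (g ^ nat (- ?j) * weight_prod ?j k) * (cmod (x' ?j) * (1 / cmod z) ^ (k + 1))"
        by simp
      also have "\<dots> \<le> (C * ((1 + g) * mu) ^ k / fact k) * (cmod (x' ?j) * (1 / cmod z) ^ (k + 1))"
        by (intro mult_right_mono C(2)) auto
      also have "\<dots> = d k / mu ^ k * cmod (x' ?j)"
      proof -
        have "s ^ k = ((1 + g) * mu) ^ k * mu ^ k * (1 / cmod z) ^ k"
          by (simp add: s_def mu(2)[symmetric] power_mult_distrib[symmetric] mult_ac)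
        then show ?thesis using mu(1) by (simp add: d_def mult_ac)
      qed
      finally show ?thesis .
    qed
    have sm: "summable (\<lambda>k. norm (x (m - int k) * of_real (weight_prod (m - int k) k) * (1 / z) ^ (k + 1)))" for m
    proof -
      have eq: "norm (x (m - int k) * of_real (weight_prod (m - int k) k) * (1 / z) ^ (k + 1))
          = cmod (1 / z) * norm (x (m - int k) * of_real (weight_prod (m - int k) k) * (1 / z) ^ k)" for k
        by (simp add: norm_mult norm_power norm_divide)
      show ?thesis unfolding eq by (rule summable_mult[OF summable_norm_resolvent_series[OF xB]])
    qed
    have sd: "summable (\<lambda>k. d k / mu ^ k * cmod (x' (m - int k)))" for m
    proof (rule summable_comparison_test_ev[OF _ summable_mult2[OF sums_summable[OF ds], of "lp_norm p x'"]])
      have "norm (d k / mu ^ k * cmod (x' (m - int k))) \<le> d k * lp_norm p x'" for k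
      proof -
        have "d k / mu ^ k \<le> d k" using d0[of k] mu(1)
          by (simp add: divide_le_eq mult_le_cancel_left1)
        then have "d k / mu ^ k * cmod (x' (m - int k)) \<le> d k * lp_norm p x'"
          using d0[of k] x'B[of "m - int k"] by (intro mult_mono) auto
        then show ?thesis using d0[of k] mu(1) by simp
      qed
      then show "\<forall>\<^sub>F k in sequentially. norm (d k / mu ^ k * cmod (x' (m - int k))) \<le> d k * lp_norm p x'"
        by simp
    qed
    have pt: "cmod (resolvent_series z x m) \<le> (\<Sum>k. d k / mu ^ k * cmod (x' (m - int k)))" for m
      unfolding resolvent_series_def
      by (rule order.trans[OF summable_norm[OF sm] suminf_le[OF trm sm sd]])
    show ?thesis
      using lp_convolution_bound[OF p mu(1) d0 ds x' pt] by (simp add: s_def)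
  qed
  show ?thesis
  proof (intro exI[of _ "mu / (mu - 1) * C"] conjI allI impI)
    show "mu / (mu - 1) * C > 0" using mu(1) C by simp
  qed (use main in blast)+
qed

end

section \<open>Exponential rates at the origin\<close>

text \<open>
  The rate of a positive \<open>F\<close> is \<open>s\<close> if \<open>F z\<close> behaves like \<open>exp (s / \<bar>z\<bar>)\<close>, that is, if
  \<open>\<bar>z\<bar> * ln (F z)\<close> tends to \<open>s\<close>. Constants and powers of \<open>\<bar>z\<bar>\<close> do not affect it.
\<close>

lemma exp_rate_tendsto:
  assumes A: "A > 0"
  shows "((\<lambda>z::complex. cmod z * ln (A / cmod z * exp (s / cmod z))) \<longlongrightarrow> s) (at 0)"
proof -
  have "((\<lambda>r. r * ln A - r * ln r + s) \<longlongrightarrow> s) (at_right (0::real))" by real_asymp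
  moreover have "\<forall>\<^sub>F r in at_right 0. r * ln A - r * ln r + s = r * ln (A / r * exp (s / r))"
    using eventually_at_right_less[of "0::real"]
  proof eventually_elim
    case (elim r)
    then have "ln (A / r * exp (s / r)) = ln A - ln r + s / r"
      using A by (simp add: ln_mult ln_div)
    then have "r * ln (A / r * exp (s / r)) = r * (ln A - ln r + s / r)" by simp
    then show ?case using elim by (simp add: distrib_left right_diff_distrib)
  qed
  ultimately have *: "((\<lambda>r. r * ln (A / r * exp (s / r))) \<longlongrightarrow> s) (at_right 0)"
    by (rule Lim_transform_eventually)
  have "filterlim cmod (at_right 0) (at 0)"
    by (auto simp: filterlim_at eventually_at_filter intro!: tendsto_eq_intros always_eventually)
  from filterlim_compose[OF * this] show ?thesis .
qed

lemma exp_rate_upper: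
  assumes k: "k \<ge> 0" and y: "k < y"
    and le: "\<And>lam. lam > 1 \<Longrightarrow> \<exists>A>0. \<forall>z. z \<noteq> 0 \<longrightarrow> F z \<le> A / cmod z * exp (k * lam / cmod z)"
    and F: "\<And>z. z \<noteq> 0 \<Longrightarrow> F z > 0"
  shows "\<forall>\<^sub>F z in at 0. cmod z * ln (F z) < y"
proof -
  \<comment> \<open>This makes \<open>k * lam < y\<close>, also for \<open>k = 0\<close>.\<close>
  define lam where "lam = 1 + (y - k) / (2 * (k + 1))"
  have lam: "lam > 1" using k y by (simp add: lam_def)
  have "k * ((y - k) / (2 * (k + 1))) \<le> (y - k) / 2"
    using k y by (simp add: field_simps)
  moreover have "k * lam = k + k * ((y - k) / (2 * (k + 1)))"
    by (simp only: lam_def distrib_left mult_1_right)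
  ultimately have kl: "k * lam < y" using y by (simp only: field_sum_of_halves) argo
  from le[OF lam] obtain A where A: "A > 0"
    and le: "\<And>z. z \<noteq> 0 \<Longrightarrow> F z \<le> A / cmod z * exp (k * lam / cmod z)" by blast
  have "\<forall>\<^sub>F z in at 0. cmod z * ln (A / cmod z * exp (k * lam / cmod z)) < y"
    by (rule order_tendstoD(2)[OF exp_rate_tendsto[OF A] kl])
  moreover have "\<forall>\<^sub>F z in at (0::complex). z \<noteq> 0" by (simp add: eventually_at_filter)
  ultimately show ?thesis
  proof eventually_elim
    case (elim z)
    have "ln (F z) \<le> ln (A / cmod z * exp (k * lam / cmod z))"
      using le[OF elim(2)] F[OF elim(2)] by (intro ln_mono)
    then have "cmod z * ln (F z) \<le> cmod z * ln (A / cmod z * exp (k * lam / cmod z))"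
      by (intro mult_left_mono) auto
    with elim(1) show ?case by linarith
  qed
qed

text \<open>
  The lower bound on \<open>t\<close> is a condition at each point \<open>z\<close>, so that the lemma serves for functions that
  are large in a whole neighbourhood of 0 as well as for those that are large at some points only.
\<close>

lemma exp_rate_lower:
  assumes k: "k > 0" and y: "y < k"
  shows "\<exists>lam>1. \<forall>A>0. \<forall>\<^sub>F z in at 0.
    \<forall>t. A / cmod z * exp (k / lam / cmod z) \<le> t \<longrightarrow> y < cmod z * ln t"
proof -
  \<comment> \<open>With a positive \<open>y'\<close> between \<open>y\<close> and \<open>k\<close>, this \<open>lam\<close> makes \<open>k / lam\<close> the mean of \<open>k\<close> and \<open>y'\<close>.\<close>
  define y' where "y' = max y (k / 2)"
  define lam where "lam = 2 * k / (k + y')"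
  have y': "y \<le> y'" "0 < y'" "y' < k" using k y by (auto simp: y'_def)
  have lam: "lam > 1" using k y' by (simp add: lam_def)
  have "k / lam = (k + y') / 2" using k y' by (simp add: lam_def)
  then have kl: "y < k / lam" using y' by simp
  have "\<forall>\<^sub>F z in at 0. \<forall>t. A / cmod z * exp (k / lam / cmod z) \<le> t \<longrightarrow> y < cmod z * ln t"
    if A: "A > 0" for A
  proof -
    have "\<forall>\<^sub>F z in at 0. y < cmod z * ln (A / cmod z * exp (k / lam / cmod z))"
      by (rule order_tendstoD(1)[OF exp_rate_tendsto[OF A] kl])
    moreover have "\<forall>\<^sub>F z in at (0::complex). z \<noteq> 0" by (simp add: eventually_at_filter)
    ultimately show ?thesis
    proof eventually_elim
      case (elim z)
      have "y < cmod z * ln t" if "A / cmod z * exp (k / lam / cmod z) \<le> t" for t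
      proof -
        have "0 < A / cmod z * exp (k / lam / cmod z)" using A elim(2) by simp
        with that have "ln (A / cmod z * exp (k / lam / cmod z)) \<le> ln t" by (intro ln_mono)
        then have "cmod z * ln (A / cmod z * exp (k / lam / cmod z)) \<le> cmod z * ln t"
          by (intro mult_left_mono) auto
        with elim(1) show ?thesis by linarith
      qed
      then show ?case by blast
    qed
  qed
  with lam show ?thesis by blast
qed

lemma frequently_at_0_of_circles:
  assumes "\<And>r. r > 0 \<Longrightarrow> \<exists>z. cmod z = r \<and> P z"
  shows "\<exists>\<^sub>F z in at (0::complex). P z"
  unfolding frequently_def
proof
  assume "\<forall>\<^sub>F z in at 0. \<not> P z"
  then obtain d where d: "d > 0" "\<And>z. z \<noteq> 0 \<Longrightarrow> cmod z < d \<Longrightarrow> \<not> P z"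
    by (auto simp: eventually_at)
  obtain z where "cmod z = d / 2" "P z" using assms[of "d / 2"] d(1) by auto
  with d show False by (auto simp: dest: d(2))
qed

lemma Limsup_quotient_le:
  fixes f g :: "'a \<Rightarrow> real"
  assumes g: "(g \<longlongrightarrow> 2) F" and f: "\<And>y. k < y \<Longrightarrow> \<forall>\<^sub>F z in F. f z < y"
  shows "Limsup F (\<lambda>z. ereal (f z / g z)) \<le> ereal (k / 2)"
  unfolding Limsup_le_iff
proof (intro allI impI)
  fix y assume "ereal (k / 2) < y"
  then obtain y' where y': "k / 2 < y'" "ereal y' < y"
    using ereal_dense2[of "ereal (k / 2)" y] by auto
  define e where "e = k / 2 + y'"
  have "((\<lambda>z. e / g z) \<longlongrightarrow> e / 2) F" by (intro tendsto_divide g tendsto_const) simp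
  moreover have "e / 2 < y'" "k < e" using y' by (auto simp: e_def)
  ultimately have "\<forall>\<^sub>F z in F. e / g z < y'" by (intro order_tendstoD(2))
  moreover have "\<forall>\<^sub>F z in F. 0 < g z" using g by (intro order_tendstoD(1)) auto
  ultimately show "\<forall>\<^sub>F z in F. ereal (f z / g z) < y"
    using f[OF \<open>k < e\<close>]
  proof eventually_elim
    case (elim z)
    have "f z / g z \<le> e / g z" using elim by (intro divide_right_mono) auto
    with elim(1) have "ereal (f z / g z) < ereal y'" by simp
    then show ?case using y'(2) by (rule less_trans)
  qed
qed

lemma Limsup_quotient_ge:
  fixes f g :: "'a \<Rightarrow> real"
  assumes g: "(g \<longlongrightarrow> 2) F" and f: "\<And>y. y < k \<Longrightarrow> \<exists>\<^sub>F z in F. y < f z"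
  shows "ereal (k / 2) \<le> Limsup F (\<lambda>z. ereal (f z / g z))"
proof (rule ccontr)
  assume "\<not> ?thesis"
  then obtain y where y: "Limsup F (\<lambda>z. ereal (f z / g z)) < ereal y" "y < k / 2"
    using ereal_dense2[of _ "ereal (k / 2)"] by (auto simp: not_le)
  define e where "e = k / 2 + y"
  have "((\<lambda>z. e / g z) \<longlongrightarrow> e / 2) F" by (intro tendsto_divide g tendsto_const) simp
  moreover have "y < e / 2" "e < k" using y(2) by (auto simp: e_def)
  ultimately have "\<forall>\<^sub>F z in F. y < e / g z" by (intro order_tendstoD(1))
  moreover have "\<forall>\<^sub>F z in F. 0 < g z" using g by (intro order_tendstoD(1)) auto
  moreover have "\<forall>\<^sub>F z in F. ereal (f z / g z) < ereal y" using y(1) by (rule Limsup_lessD)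
  ultimately have "\<forall>\<^sub>F z in F. \<not> e < f z"
  proof eventually_elim
    case (elim z)
    then have "f z / g z < e / g z" by simp
    then show ?case using elim(2) by (simp add: divide_less_cancel)
  qed
  with f[OF \<open>e < k\<close>] show False by (simp add: frequently_def)
qed

section \<open>Power indices\<close>

locale reciprocal_shift = reciprocal_weights +
  fixes p :: real and T :: "(int \<Rightarrow> complex) \<Rightarrow> int \<Rightarrow> complex"
  assumes p: "p \<ge> 1"
    and shift: "\<And>x. x \<in> lp p \<Longrightarrow> T x = (\<lambda>m. of_real (a (m - 1)) * x (m - 1))"
begin

lemma p_pos: "p > 0"
  using p by simp

lemma resolvent_series_lp:
  assumes "z \<noteq> 0" "x \<in> lp p"
  shows "resolvent_series z x \<in> lp p"
  using resolvent_series_norm_le[OF p, of 2 1] assms by auto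

lemma lp_resolvent_eq:
  assumes z: "z \<noteq> 0" and x: "x \<in> lp p"
  shows "lp_resolvent p T z x = resolvent_series z x"
  unfolding lp_resolvent_def
proof (rule the_inv_into_f_eq)
  show "inj_on (\<lambda>x k. z * x k - T x k) (lp p)"
  proof (rule inj_onI)
    fix u v assume u: "u \<in> lp p" and v: "v \<in> lp p"
      and eq: "(\<lambda>k. z * u k - T u k) = (\<lambda>k. z * v k - T v k)"
    have "u m - v m = 0" for m
    proof (rule bounded_eigensequence_zero[OF _ z])
      show "cmod (u j - v j) \<le> lp_norm p u + lp_norm p v" for j
        using norm_triangle_ineq4[of "u j" "v j"] norm_le_lp_norm[OF p_pos u, of j]
          norm_le_lp_norm[OF p_pos v, of j] by linarith
      show "z * (u m - v m) = of_real (a (m - 1)) * (u (m - 1) - v (m - 1))" for m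
        using fun_cong[OF eq, of m] by (simp add: shift u v algebra_simps)
    qed
    then show "u = v" by (intro ext) simp
  qed
  show "resolvent_series z x \<in> lp p" by (rule resolvent_series_lp[OF z x])
  then show "(\<lambda>k. z * resolvent_series z x k - T (resolvent_series z x) k) = x"
    using resolvent_series_solves[OF norm_le_lp_norm[OF p_pos x] z] by (simp add: shift)
qed

lemma resolvent_series_nonzero:
  assumes z: "z \<noteq> 0" and x: "x \<in> lp p" "x \<noteq> (\<lambda>_. 0)"
  shows "lp_norm p (resolvent_series z x) > 0"
proof (rule lp_norm_pos[OF p_pos resolvent_series_lp[OF z x(1)]])
  show "resolvent_series z x \<noteq> (\<lambda>_. 0)"
  proof
    assume "resolvent_series z x = (\<lambda>_. 0)"
    then have "x m = 0" for m
      using resolvent_series_solves[where x = x and B = "lp_norm p x" and z = z and m = m]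
        norm_le_lp_norm[OF p_pos x(1)] z by simp
    with x(2) show False by blast
  qed
qed

lemma lp_opnorm_resolvent_eq:
  assumes "z \<noteq> 0"
  shows "lp_opnorm p (lp_resolvent p T z)
    = (SUP x\<in>{x\<in>lp p. lp_norm p x \<le> 1}. lp_norm p (resolvent_series z x))"
  unfolding lp_opnorm_def using assms by (intro SUP_cong) (auto simp: lp_resolvent_eq)

text \<open>
  The second part uses the first: a supremum says something about its members only if they are
  bounded.
\<close>

lemma opnorm_resolvent_bounds:
  assumes lam: "lam > 1"
  shows "\<exists>A>0. \<forall>z. z \<noteq> 0 \<longrightarrow>
    lp_opnorm p (lp_resolvent p T z) \<le> A / cmod z * exp (2 * lam / cmod z) \<and>
    (\<forall>x\<in>lp p. lp_norm p x \<le> 1 \<longrightarrow>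
      lp_norm p (resolvent_series z x) \<le> lp_opnorm p (lp_resolvent p T z))"
proof -
  from resolvent_series_norm_le[OF p lam, of 1] obtain A where A: "A > 0"
    and le: "\<And>x z. z \<noteq> 0 \<Longrightarrow> x \<in> lp p \<Longrightarrow>
      lp_norm p (resolvent_series z x) \<le> A / cmod z * exp (2 * lam / cmod z) * lp_norm p x"
    by force
  have main: "lp_opnorm p (lp_resolvent p T z) \<le> A / cmod z * exp (2 * lam / cmod z) \<and>
    (\<forall>x\<in>lp p. lp_norm p x \<le> 1 \<longrightarrow>
      lp_norm p (resolvent_series z x) \<le> lp_opnorm p (lp_resolvent p T z))" if z: "z \<noteq> 0" for z
  proof -
    let ?U = "{x\<in>lp p. lp_norm p x \<le> 1}"
    have ub: "lp_norm p (resolvent_series z x) \<le> A / cmod z * exp (2 * lam / cmod z)"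
      if "x \<in> ?U" for x
    proof -
      have "A / cmod z * exp (2 * lam / cmod z) * lp_norm p x
          \<le> A / cmod z * exp (2 * lam / cmod z) * 1"
        using that A by (intro mult_left_mono) auto
      with le[OF z, of x] that show ?thesis by simp
    qed
    have ne: "?U \<noteq> {}" using lp_basis_lp[OF p_pos, of 0] by auto
    have "bdd_above ((\<lambda>x. lp_norm p (resolvent_series z x)) ` ?U)"
      using ub by (rule bdd_aboveI2)
    then have "\<forall>x\<in>?U. lp_norm p (resolvent_series z x) \<le> lp_opnorm p (lp_resolvent p T z)"
      unfolding lp_opnorm_resolvent_eq[OF z] by (intro ballI cSUP_upper)
    moreover have "lp_opnorm p (lp_resolvent p T z) \<le> A / cmod z * exp (2 * lam / cmod z)"
      unfolding lp_opnorm_resolvent_eq[OF z] using ne ub by (rule cSUP_least)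
    ultimately show ?thesis by blast
  qed
  then show ?thesis using A by blast
qed

lemma norm_resolvent_series_ge:
  assumes "z \<noteq> 0" "x \<in> lp p"
  shows "cmod (resolvent_series z x m) \<le> lp_norm p (resolvent_series z x)"
  by (intro norm_le_lp_norm p_pos resolvent_series_lp assms)

lemma resolvent_series_basis:
  "resolvent_series z (lp_basis j) (j + int k) = of_real (weight_prod j k) * (1 / z) ^ (k + 1)"
proof -
  have "resolvent_series z (lp_basis j) (j + int k)
      = (\<Sum>i. if i = k then of_real (weight_prod j k) * (1 / z) ^ (k + 1) else 0)"
    unfolding resolvent_series_def by (intro suminf_cong) (auto simp: lp_basis_def)
  also have "\<dots> = of_real (weight_prod j k) * (1 / z) ^ (k + 1)"
    using sums_If_finite_set[of "{k}" "\<lambda>_. of_real (weight_prod j k) * (1 / z) ^ (k + 1)"]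
    by (simp add: sums_iff)
  finally show ?thesis .
qed

text \<open>
  The resolvent at one basis vector \<open>lp_basis (- n)\<close> already has a coordinate of the required size,
  whose modulus depends on \<open>\<bar>z\<bar>\<close> only.
\<close>

lemma opnorm_resolvent_ge:
  assumes lam: "lam > 1"
  shows "\<exists>A>0. \<forall>z. z \<noteq> 0 \<longrightarrow>
    A / cmod z * exp (2 / lam / cmod z) \<le> lp_opnorm p (lp_resolvent p T z)"
proof -
  obtain c where c: "c > 0" and ex: "\<And>r. r > 0 \<Longrightarrow> \<exists>n m. c * exp ((1 + 1) * r / lam)
    \<le> 1 ^ n / (real n + 1) ^ 2 * r ^ (n + m) * weight_prod (- int n) (n + m)"
    using large_coefficient[OF lam, of 1] by auto
  have "c / cmod z * exp (2 / lam / cmod z) \<le> lp_opnorm p (lp_resolvent p T z)"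
    if z: "z \<noteq> 0" for z
  proof -
    define r where "r = 1 / cmod z"
    have r: "r > 0" using z by (simp add: r_def)
    obtain n m where nm: "c * exp (2 * r / lam)
        \<le> 1 / (real n + 1) ^ 2 * (r ^ (n + m) * weight_prod (- int n) (n + m))"
      using ex[OF r] by (auto simp: mult.assoc)
    have "1 / (real n + 1) ^ 2 \<le> (1::real)" by simp
    then have "1 / (real n + 1) ^ 2 * (r ^ (n + m) * weight_prod (- int n) (n + m))
        \<le> 1 * (r ^ (n + m) * weight_prod (- int n) (n + m))"
      using r weight_prod_pos[of "- int n" "n + m"] by (intro mult_right_mono) auto
    with nm have "r * (c * exp (2 * r / lam)) \<le> r * (r ^ (n + m) * weight_prod (- int n) (n + m))"
      using r by (intro mult_left_mono) auto
    also have "\<dots> = cmod (resolvent_series z (lp_basis (- int n)) (- int n + int (n + m)))"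
      using weight_prod_pos[of "- int n" "n + m"]
      by (subst resolvent_series_basis) (simp add: norm_mult norm_power norm_divide r_def)
    also have "\<dots> \<le> lp_norm p (resolvent_series z (lp_basis (- int n)))"
      by (intro norm_resolvent_series_ge z lp_basis_lp p_pos)
    also have "\<dots> \<le> lp_opnorm p (lp_resolvent p T z)"
      using opnorm_resolvent_bounds[of 2] z lp_basis_lp[OF p_pos] by auto
    finally show ?thesis by (simp add: r_def mult_ac)
  qed
  with c show ?thesis by blast
qed

lemma opnorm_resolvent_rate:
  "((\<lambda>z. cmod z * ln (lp_opnorm p (lp_resolvent p T z))) \<longlongrightarrow> 2) (at 0)"
proof (rule order_tendstoI)
  fix y :: real
  assume "y < 2"
  from exp_rate_lower[OF _ this] obtain lam where lam: "lam > 1"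
    and ev: "\<And>A. A > 0 \<Longrightarrow> \<forall>\<^sub>F z in at 0.
      \<forall>t. A / cmod z * exp (2 / lam / cmod z) \<le> t \<longrightarrow> y < cmod z * ln t"
    by auto
  obtain A where A: "A > 0"
    and ge: "\<And>z. z \<noteq> 0 \<Longrightarrow> A / cmod z * exp (2 / lam / cmod z) \<le> lp_opnorm p (lp_resolvent p T z)"
    using opnorm_resolvent_ge[OF lam] by blast
  have "\<forall>\<^sub>F z in at (0::complex). z \<noteq> 0" by (simp add: eventually_at_filter)
  with ev[OF A] show "\<forall>\<^sub>F z in at 0. y < cmod z * ln (lp_opnorm p (lp_resolvent p T z))"
    by eventually_elim (use ge in blast)
next
  fix y :: real
  assume y: "2 < y"
  show "\<forall>\<^sub>F z in at 0. cmod z * ln (lp_opnorm p (lp_resolvent p T z)) < y"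
  proof (rule exp_rate_upper[OF _ y])
    fix z :: complex
    assume z: "z \<noteq> 0"
    obtain A where A: "A > 0"
      "\<And>z. z \<noteq> 0 \<Longrightarrow> A / cmod z * exp (2 / 2 / cmod z) \<le> lp_opnorm p (lp_resolvent p T z)"
      using opnorm_resolvent_ge[of 2] by auto
    have "0 < A / cmod z * exp (2 / 2 / cmod z)" using A(1) z by simp
    with A(2)[OF z] show "0 < lp_opnorm p (lp_resolvent p T z)" by linarith
  qed (use opnorm_resolvent_bounds in \<open>simp, blast\<close>)
qed

text \<open>
  Multiplying numerator and denominator by \<open>\<bar>z\<bar>\<close> turns the denominator into a function with limit 2,
  so that a power index is half the upper rate of the norm of \<open>resolvent_series z x\<close>.
\<close>

lemma power_index_eq:
  assumes "x \<in> lp p"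
  shows "power_index p T x = Limsup (at 0) (\<lambda>z.
    ereal ((cmod z * ln (lp_norm p (resolvent_series z x))) /
           (cmod z * ln (lp_opnorm p (lp_resolvent p T z)))))"
  unfolding power_index_def
  by (rule Limsup_eq) (simp add: eventually_at_filter lp_resolvent_eq assms)

lemma power_index_le:
  assumes x: "x \<in> lp p" "x \<noteq> (\<lambda>_. 0)" and k: "k \<ge> 0"
    and le: "\<And>lam. lam > 1 \<Longrightarrow> \<exists>A>0. \<forall>z. z \<noteq> 0 \<longrightarrow>
      lp_norm p (resolvent_series z x) \<le> A / cmod z * exp (k * lam / cmod z)"
  shows "power_index p T x \<le> ereal (k / 2)"
  unfolding power_index_eq[OF x(1)]
  by (intro Limsup_quotient_le opnorm_resolvent_rate exp_rate_upper[OF k _ le]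
      resolvent_series_nonzero x)

lemma power_index_ge:
  assumes x: "x \<in> lp p" and k: "k > 0"
    and ge: "\<And>lam. lam > 1 \<Longrightarrow> \<exists>A>0. \<forall>r>0. \<exists>z. cmod z = r \<and>
      A / r * exp (k / lam / r) \<le> lp_norm p (resolvent_series z x)"
  shows "ereal (k / 2) \<le> power_index p T x"
  unfolding power_index_eq[OF x]
proof (intro Limsup_quotient_ge opnorm_resolvent_rate)
  fix y assume "y < k"
  from exp_rate_lower[OF k this] obtain lam where lam: "lam > 1"
    and ev: "\<And>A. A > 0 \<Longrightarrow> \<forall>\<^sub>F z in at 0.
      \<forall>t. A / cmod z * exp (k / lam / cmod z) \<le> t \<longrightarrow> y < cmod z * ln t"
    by auto
  obtain A where A: "A > 0" and ex: "\<And>r. r > 0 \<Longrightarrow> \<exists>z. cmod z = r \<and>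
      A / r * exp (k / lam / r) \<le> lp_norm p (resolvent_series z x)"
    using ge[OF lam] by blast
  have fr: "\<exists>\<^sub>F z in at 0. A / cmod z * exp (k / lam / cmod z) \<le> lp_norm p (resolvent_series z x)"
    by (rule frequently_at_0_of_circles) (use ex in blast)
  show "\<exists>\<^sub>F z in at 0. y < cmod z * ln (lp_norm p (resolvent_series z x))"
    by (rule frequently_mp[OF eventually_mono[OF ev[OF A]] fr]) (rule spec)
qed

lemma power_index_le_1:
  assumes x: "x \<in> lp p" "x \<noteq> (\<lambda>_. 0)"
  shows "power_index p T x \<le> ereal 1"
proof -
  have "power_index p T x \<le> ereal (2 / 2)"
  proof (rule power_index_le[OF x])
    fix lam :: real assume lam: "lam > 1"
    from resolvent_series_norm_le[OF p lam, of 1] obtain A where A: "A > 0"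
      and le: "\<And>x z. z \<noteq> 0 \<Longrightarrow> x \<in> lp p \<Longrightarrow>
        lp_norm p (resolvent_series z x) \<le> A / cmod z * exp (2 * lam / cmod z) * lp_norm p x"
      by force
    show "\<exists>A>0. \<forall>z. z \<noteq> 0 \<longrightarrow>
        lp_norm p (resolvent_series z x) \<le> A / cmod z * exp (2 * lam / cmod z)"
      using A le[OF _ x(1)] lp_norm_pos[OF p_pos x]
      by (intro exI[of _ "A * lp_norm p x"]) (simp add: mult_ac)
  qed simp
  then show ?thesis by simp
qed

text \<open>
  Let \<open>x j\<close> be a nonzero coordinate. As a power series in \<open>1 / z\<close>, coordinate \<open>j + k\<close> of the
  resolvent at \<open>x\<close> has the coefficient \<open>x j * weight_prod j k\<close>, of size about \<open>1 / k!\<close>. By Cauchy's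
  estimate the other coordinates of \<open>x\<close> cannot cancel this contribution on a whole circle; with the
  best \<open>k\<close> it is about \<open>exp (1 / \<bar>z\<bar>)\<close>. This yields some \<open>z\<close> on every circle, which is enough for an
  upper limit.
\<close>

lemma power_index_ge_half:
  assumes x: "x \<in> lp p" "x \<noteq> (\<lambda>_. 0)"
  shows "ereal (1 / 2) \<le> power_index p T x"
proof (rule power_index_ge[OF x(1)])
  obtain j where j: "x j \<noteq> 0" using x(2) by auto
  fix lam :: real assume lam: "lam > 1"
  \<comment> \<open>One factor \<open>mu\<close> is lost in the weights and one in the choice of a large term.\<close>
  define mu where "mu = sqrt lam"
  have mu: "mu > 1" "mu * mu = lam" using lam by (auto simp: mu_def)
  obtain c where c: "c > 0" "\<And>k. c * (1 / mu) ^ k / fact k \<le> weight_prod j k"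
    using weight_prod_ge[OF mu(1)] by blast
  define A where "A = cmod (x j) / 2 * c * (1 - 1 / mu)"
  have A: "A > 0" using j c(1) mu(1) by (simp add: A_def)
  have "\<exists>z. cmod z = r \<and> A / r * exp (1 / lam / r) \<le> lp_norm p (resolvent_series z x)"
    if r: "r > 0" for r
  proof -
    obtain k where k: "(1 - 1 / mu) * exp (1 / r / mu / mu) \<le> (1 / r / mu) ^ k / fact k"
      using exp_series_large_term[of "1 / r / mu" mu] r mu by auto
    define d where "d i = x (j + int k - int i) * of_real (weight_prod (j + int k - int i) i)" for i
    have "summable (\<lambda>i. d i * u ^ i)" for u unfolding d_def
      by (rule summable_norm_cancel[OF summable_norm_resolvent_series[OF norm_le_lp_norm[OF p_pos x(1)]]])
    moreover have "d k \<noteq> 0" using j weight_prod_pos[of j k] by (simp add: d_def)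
    ultimately obtain u where u: "cmod u = 1 / r"
        and ge: "cmod (d k) * (1 / r) ^ k / 2 \<le> cmod (\<Sum>i. d i * u ^ i)"
      using coefficient_bounded_on_circle[of d "1 / r" k] r by auto
    have u0: "u \<noteq> 0" using u r by auto
    have cz: "cmod (1 / u) = r" using u r by (simp add: norm_divide)
    have "A * exp (1 / lam / r) = cmod (x j) / 2 * (c * ((1 - 1 / mu) * exp (1 / r / mu / mu)))"
      by (simp add: A_def mu(2)[symmetric] mult_ac)
    also have "\<dots> \<le> cmod (x j) / 2 * (c * ((1 / r / mu) ^ k / fact k))"
      using c(1) k by (intro mult_left_mono) auto
    also have "\<dots> = cmod (x j) / 2 * ((c * (1 / mu) ^ k / fact k) * (1 / r) ^ k)"
      by (simp add: power_divide power_mult_distrib)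
    also have "\<dots> \<le> cmod (x j) / 2 * (weight_prod j k * (1 / r) ^ k)"
      using r by (intro mult_left_mono mult_right_mono c(2)) auto
    also have "\<dots> = cmod (d k) * (1 / r) ^ k / 2"
      using weight_prod_pos[of j k] by (simp add: d_def norm_mult)
    also note ge
    finally have "A / r * exp (1 / lam / r) \<le> cmod (\<Sum>i. d i * u ^ i) / r"
      using r by (simp add: divide_right_mono)
    also have "\<dots> = cmod (resolvent_series (1 / u) x (j + int k))"
      using u by (subst resolvent_series_eq_power_series[OF norm_le_lp_norm[OF p_pos x(1)]])
        (simp add: d_def norm_mult)
    also have "\<dots> \<le> lp_norm p (resolvent_series (1 / u) x)"
      using u0 by (intro norm_resolvent_series_ge x) auto
    finally show ?thesis using cz by blast
  qed
  then show "\<exists>A>0. \<forall>r>0. \<exists>z. cmod z = r \<and>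
      A / r * exp (1 / lam / r) \<le> lp_norm p (resolvent_series z x)" using A by blast
qed simp

text \<open>
  The vectors that realise all the indices. The square in the denominator keeps them summable for
  \<open>g = 1\<close>; for \<open>g = 0\<close> the convention \<open>0 ^ 0 = 1\<close> leaves the basis vector at 0.
\<close>

definition geometric_tail :: "real \<Rightarrow> int \<Rightarrow> complex" where
  "geometric_tail g j = (if j \<le> 0 then of_real (g ^ nat (- j) / (real (nat (- j)) + 1) ^ 2) else 0)"

lemma geometric_tail_le:
  assumes "0 \<le> g"
  shows "cmod (geometric_tail g j) \<le> g ^ nat (- j) * cmod (geometric_tail 1 j)"
  using assms by (simp add: geometric_tail_def norm_mult norm_divide norm_power)

lemma geometric_tail_lp:
  assumes g: "0 \<le> g" "g \<le> 1"
  shows "geometric_tail g \<in> lp p"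
proof -
  let ?h = "\<lambda>j. cmod (geometric_tail g j) powr p"
  have le: "cmod (geometric_tail g (- int n)) powr p \<le> 1 / real (Suc n) ^ 2" for n
  proof -
    define t where "t = g ^ n / (real n + 1) ^ 2"
    have t: "0 \<le> t" "t \<le> 1 / real (Suc n) ^ 2"
      using g by (auto simp: t_def power_le_one add.commute intro!: divide_right_mono)
    moreover have "1 / real (Suc n) ^ 2 \<le> 1" by (simp add: divide_le_eq)
    ultimately have t1: "t \<le> 1" by linarith
    have "t powr p \<le> t powr 1"
      using t t1 p by (intro powr_mono') auto
    moreover have "cmod (geometric_tail g (- int n)) = t"
      using t(1) g by (simp add: geometric_tail_def t_def del: of_real_divide of_real_power)
    ultimately show ?thesis using t by simp
  qed
  have "summable (\<lambda>n. 1 / real (Suc n) ^ 2)"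
    using inverse_power_summable[of 2, where 'a=real] by (subst summable_Suc_iff) (simp add: field_simps)
  then have "summable (\<lambda>n. ?h (- int n))"
    by (rule summable_comparison_test_ev[OF always_eventually, rotated]) (use le in simp)
  then have "(\<lambda>n. ?h (- int n)) summable_on UNIV"
    by (subst summable_on_UNIV_nonneg_real_iff) auto
  then have "?h summable_on range (\<lambda>n. - int n)"
    by (subst summable_on_reindex) (auto simp: inj_on_def o_def)
  then have "?h summable_on UNIV"
  proof (rule summable_on_cong_neutral[THEN iffD1, rotated -1])
    fix j :: int assume "j \<in> UNIV - range (\<lambda>n. - int n)"
    have "j > 0"
    proof (rule ccontr)
      assume "\<not> j > 0"
      then have "j = - int (nat (- j))" by simp
      then have "j \<in> range (\<lambda>n. - int n)" by (rule range_eqI)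
      with \<open>j \<in> UNIV - range (\<lambda>n. - int n)\<close> show False by blast
    qed
    then show "?h j = 0" using p_pos by (simp add: geometric_tail_def)
  qed auto
  then show ?thesis by (simp add: lp_def)
qed

lemma geometric_tail_nonzero: "geometric_tail g \<noteq> (\<lambda>_. 0)"
  by (auto simp: geometric_tail_def fun_eq_iff intro!: exI[of _ 0])

text \<open>
  The rate is at most \<open>1 + g\<close> by \<open>resolvent_series_norm_le\<close>, with \<open>geometric_tail 1\<close> as the dominating
  vector. It is attained along the positive axis: for \<open>z > 0\<close> the terms of the resolvent series are
  nonnegative, so a coordinate is at least any one of them.
\<close>

lemma power_index_geometric_tail:
  assumes g: "0 \<le> g" "g \<le> 1"
  shows "power_index p T (geometric_tail g) = ereal ((1 + g) / 2)"
proof (rule antisym)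
  show "power_index p T (geometric_tail g) \<le> ereal ((1 + g) / 2)"
  proof (rule power_index_le[OF geometric_tail_lp[OF g] geometric_tail_nonzero])
    fix lam :: real assume lam: "lam > 1"
    from resolvent_series_norm_le[OF p lam g] obtain A where A: "A > 0"
      and le: "\<And>x x' z. z \<noteq> 0 \<Longrightarrow> x' \<in> lp p \<Longrightarrow> (\<And>j. cmod (x j) \<le> g ^ nat (- j) * cmod (x' j)) \<Longrightarrow>
        lp_norm p (resolvent_series z x) \<le> A / cmod z * exp ((1 + g) * lam / cmod z) * lp_norm p x'"
      by blast
    show "\<exists>A>0. \<forall>z. z \<noteq> 0 \<longrightarrow> lp_norm p (resolvent_series z (geometric_tail g))
        \<le> A / cmod z * exp ((1 + g) * lam / cmod z)"
      using A le[OF _ geometric_tail_lp geometric_tail_le[OF g(1)]]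
        lp_norm_pos[OF p_pos geometric_tail_lp geometric_tail_nonzero, of 1]
      by (intro exI[of _ "A * lp_norm p (geometric_tail 1)"]) (simp add: mult_ac)
  qed (use g in simp)
  show "ereal ((1 + g) / 2) \<le> power_index p T (geometric_tail g)"
  proof (rule power_index_ge[OF geometric_tail_lp[OF g]])
    fix lam :: real assume lam: "lam > 1"
    obtain c where c: "c > 0" and ex: "\<And>r. r > 0 \<Longrightarrow> \<exists>n m. c * exp ((1 + g) * r / lam)
        \<le> g ^ n / (real n + 1) ^ 2 * r ^ (n + m) * weight_prod (- int n) (n + m)"
      using large_coefficient[OF lam g(1)] by auto
    have "c / r * exp ((1 + g) / lam / r)
        \<le> lp_norm p (resolvent_series (of_real r) (geometric_tail g))" if r: "r > 0" for r
    proof -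
      obtain n m where nm: "c * exp ((1 + g) * (1 / r) / lam)
          \<le> g ^ n / (real n + 1) ^ 2 * (1 / r) ^ (n + m) * weight_prod (- int n) (n + m)"
        using ex[of "1 / r"] r by auto
      define t where "t k = (if int m - int k \<le> 0
          then g ^ nat (int k - int m) / (real (nat (int k - int m)) + 1) ^ 2 else 0)
          * weight_prod (int m - int k) k * (1 / r) ^ k" for k
      have t0: "t k \<ge> 0" for k
        using g r weight_prod_pos[of "int m - int k" k] by (simp add: t_def)
      have tc: "geometric_tail g (int m - int k) * of_real (weight_prod (int m - int k) k)
          * (1 / of_real r) ^ k = complex_of_real (t k)" for k
        by (simp add: t_def geometric_tail_def)
      have "summable (\<lambda>k. norm (complex_of_real (t k)))"
        using summable_norm_resolvent_series[where x = "geometric_tail g" and m = "int m"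
            and u = "1 / of_real r", OF norm_le_lp_norm[OF p_pos geometric_tail_lp[OF g]]]
        unfolding tc .
      then have st: "summable t" using t0 by simp
      have "c * exp ((1 + g) * (1 / r) / lam) \<le> t (n + m)"
        using nm by (simp add: t_def mult_ac)
      also have "\<dots> \<le> suminf t"
        using sum_le_suminf[OF st, of "{n + m}"] t0 by simp
      finally have "c / r * exp ((1 + g) / lam / r) \<le> suminf t / r"
        using r by (simp add: divide_right_mono mult_ac)
      also have "\<dots> = cmod (complex_of_real (suminf t / r))"
        using r suminf_nonneg[OF st t0] by (simp del: of_real_divide)
      also have "complex_of_real (suminf t / r) = resolvent_series (of_real r) (geometric_tail g) (int m)"
        by (subst resolvent_series_eq_power_series[OF norm_le_lp_norm[OF p_pos geometric_tail_lp[OF g]]])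
           (simp add: tc suminf_of_real[OF st])
      also have "cmod \<dots> \<le> lp_norm p (resolvent_series (of_real r) (geometric_tail g))"
        using r by (intro norm_resolvent_series_ge geometric_tail_lp g) auto
      finally show ?thesis .
    qed
    moreover have "cmod (complex_of_real r) = r" if "r > 0" for r using that by simp
    ultimately show "\<exists>A>0. \<forall>r>0. \<exists>z. cmod z = r \<and>
        A / r * exp ((1 + g) / lam / r) \<le> lp_norm p (resolvent_series z (geometric_tail g))"
      using c by blast
  qed (use g in simp)
qed

theorem power_set_eq: "power_set p T = ereal ` {1/2..1}"
proof
  show "power_set p T \<subseteq> ereal ` {1/2..1}"
  proof
    fix k assume "k \<in> power_set p T"
    then obtain x where x: "x \<in> lp p" "x \<noteq> (\<lambda>_. 0)" and k: "k = power_index p T x"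
      by (auto simp: power_set_def)
    have "ereal (1 / 2) \<le> k" "k \<le> ereal 1"
      using power_index_ge_half[OF x] power_index_le_1[OF x] by (auto simp: k)
    then show "k \<in> ereal ` {1/2..1}" by (cases k) auto
  qed
  show "ereal ` {1/2..1} \<subseteq> power_set p T"
  proof
    fix k assume "k \<in> ereal ` {1/2..1}"
    then obtain s where s: "k = ereal s" "1/2 \<le> s" "s \<le> 1" by auto
    have "k = power_index p T (geometric_tail (2 * s - 1))"
      using power_index_geometric_tail[of "2 * s - 1"] s by simp
    moreover have "geometric_tail (2 * s - 1) \<in> lp p - {\<lambda>_. 0}"
      using geometric_tail_lp[of "2 * s - 1"] geometric_tail_nonzero s by auto
    ultimately show "k \<in> power_set p T" unfolding power_set_def by (rule image_eqI)
  qed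
qed

end

section \<open>Bounded operators given on the basis\<close>

lemma lp_bounded_operator_add:
  "lp_bounded_operator p T \<Longrightarrow> x \<in> lp p \<Longrightarrow> y \<in> lp p \<Longrightarrow>
    T (\<lambda>k. x k + y k) = (\<lambda>k. T x k + T y k)"
  by (simp add: lp_bounded_operator_def)

lemma bounded_operator_finite:
  assumes T: "lp_bounded_operator p T" and p: "p > 0" and M: "finite M"
  shows "(\<lambda>k. if k \<in> M then x k else 0) \<in> lp p \<and>
    T (\<lambda>k. if k \<in> M then x k else 0) = (\<lambda>m. \<Sum>j\<in>M. x j * T (lp_basis j) m)"
  using M
proof induction
  case empty
  have z: "(\<lambda>k. 0 * lp_basis 0 k) \<in> lp p" by (intro lp_scale lp_basis_lp p)
  have "T (\<lambda>k. 0 * lp_basis 0 k) = (\<lambda>k. 0 * T (lp_basis 0) k)"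
    using T lp_basis_lp(1)[OF p] unfolding lp_bounded_operator_def by blast
  with z show ?case by simp
next
  case (insert j M)
  let ?y = "\<lambda>k. if k \<in> M then x k else 0" and ?b = "\<lambda>k. x j * lp_basis j k"
  have eq: "(\<lambda>k. if k \<in> insert j M then x k else 0) = (\<lambda>k. ?b k + ?y k)"
    using insert.hyps by (auto simp: fun_eq_iff lp_basis_def)
  have b: "?b \<in> lp p" by (intro lp_scale lp_basis_lp p)
  have "T (\<lambda>k. ?b k + ?y k) = (\<lambda>k. T ?b k + T ?y k)"
    by (intro lp_bounded_operator_add[OF T b] conjunct1[OF insert.IH])
  moreover have "T ?b = (\<lambda>k. x j * T (lp_basis j) k)"
    using T lp_basis_lp(1)[OF p] unfolding lp_bounded_operator_def by blast
  ultimately have "T (\<lambda>k. ?b k + ?y k) = (\<lambda>m. \<Sum>j\<in>insert j M. x j * T (lp_basis j) m)"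
    using insert.hyps insert.IH by simp
  moreover have "(\<lambda>k. if k \<in> insert j M then x k else 0) \<in> lp p"
  proof (rule lp_normI(1)[OF p])
    let ?B = "\<Sum>k\<in>insert j M. cmod (x k) powr p"
    show "(\<Sum>m\<in>N. cmod (if m \<in> insert j M then x m else 0) powr p) \<le> (?B powr (1 / p)) powr p"
      if N: "finite N" for N
    proof -
      have "(\<Sum>m\<in>N. cmod (if m \<in> insert j M then x m else 0) powr p)
          = (\<Sum>m\<in>N \<inter> insert j M. cmod (x m) powr p)"
        using N p by (intro sum.mono_neutral_cong_right) auto
      also have "\<dots> \<le> ?B" using insert.hyps by (intro sum_mono2) auto
      also have "\<dots> = (?B powr (1 / p)) powr p" using p by (simp add: powr_powr sum_nonneg)
      finally show ?thesis .
    qed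
  qed simp
  ultimately show ?case unfolding eq by blast
qed

text \<open>
  Continuity determines the operator from its values on the basis. Truncating \<open>x\<close> to a large finite
  set splits off finitely many multiples of basis vectors; the rest has small norm, hence a small
  image, and so do its coordinates.
\<close>

lemma bounded_operator_coordinate:
  assumes T: "lp_bounded_operator p T" and p: "p > 0" and x: "x \<in> lp p" and M: "finite M"
    and nz: "\<And>j. j \<notin> M \<Longrightarrow> T (lp_basis j) m = 0"
  shows "T x m = (\<Sum>j\<in>M. x j * T (lp_basis j) m)"
proof -
  obtain C where C: "\<And>y. y \<in> lp p \<Longrightarrow> lp_norm p (T y) \<le> C * lp_norm p y"
    using T unfolding lp_bounded_operator_def by blast
  have sx: "(\<lambda>n. cmod (x n) powr p) summable_on UNIV" using x by (simp add: lp_def)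
  define D where "D = T x m - (\<Sum>j\<in>M. x j * T (lp_basis j) m)"
  have le: "cmod D \<le> max C 0 * e" if e: "e > 0" for e
  proof -
    obtain F where F: "finite F" "M \<subseteq> F"
      and tail: "(\<Sum>\<^sub>\<infinity>n. cmod (x n) powr p) - e powr p < (\<Sum>n\<in>F. cmod (x n) powr p)"
    proof -
      have "((\<lambda>F. \<Sum>n\<in>F. cmod (x n) powr p) \<longlongrightarrow> (\<Sum>\<^sub>\<infinity>n. cmod (x n) powr p)) (finite_subsets_at_top UNIV)"
        using has_sum_infsum[OF sx] by (simp add: has_sum_def)
      from order_tendstoD(1)[OF this, of "(\<Sum>\<^sub>\<infinity>n. cmod (x n) powr p) - e powr p"] e
      obtain F0 where "finite F0" "\<And>F. finite F \<Longrightarrow> F0 \<subseteq> F \<Longrightarrow>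
          (\<Sum>\<^sub>\<infinity>n. cmod (x n) powr p) - e powr p < (\<Sum>n\<in>F. cmod (x n) powr p)"
        by (auto simp: eventually_finite_subsets_at_top)
      then show ?thesis using that[of "F0 \<union> M"] M by auto
    qed
    let ?y = "\<lambda>k. if k \<in> F then x k else 0" and ?t = "\<lambda>k. if k \<in> F then 0 else x k"
    have fin: "(\<Sum>k\<in>N. cmod (?t k) powr p) \<le> e powr p" if N: "finite N" for N
    proof -
      have "(\<Sum>k\<in>N. cmod (?t k) powr p) = (\<Sum>k\<in>N - F. cmod (x k) powr p)"
        using N p by (intro sum.mono_neutral_cong_right) auto
      also have "\<dots> = (\<Sum>k\<in>N \<union> F. cmod (x k) powr p) - (\<Sum>k\<in>F. cmod (x k) powr p)"
        using N F(1) sum.subset_diff[of F "N \<union> F" "\<lambda>k. cmod (x k) powr p"] by (simp add: Un_Diff)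
      also have "(\<Sum>k\<in>N \<union> F. cmod (x k) powr p) \<le> (\<Sum>\<^sub>\<infinity>n. cmod (x n) powr p)"
        using N F(1) sx by (intro finite_sum_le_infsum) auto
      finally show ?thesis using tail by linarith
    qed
    have t: "?t \<in> lp p" "lp_norm p ?t \<le> e" using lp_normI[OF p _ fin] e by auto
    have "T x = T (\<lambda>k. ?y k + ?t k)" by (rule arg_cong[of _ _ T]) auto
    also have "\<dots> = (\<lambda>k. T ?y k + T ?t k)"
      by (intro lp_bounded_operator_add[OF T _ t(1)] conjunct1[OF bounded_operator_finite[OF T p F(1)]])
    also have "T ?y = (\<lambda>m. \<Sum>j\<in>F. x j * T (lp_basis j) m)"
      using bounded_operator_finite[OF T p F(1)] by blast
    finally have "T x m = (\<Sum>j\<in>F. x j * T (lp_basis j) m) + T ?t m" by (rule fun_cong)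
    also have "(\<Sum>j\<in>F. x j * T (lp_basis j) m) = (\<Sum>j\<in>M. x j * T (lp_basis j) m)"
      using F nz by (intro sum.mono_neutral_right) auto
    finally have "D = T ?t m" by (simp add: D_def)
    moreover have "T ?t \<in> lp p" using T t(1) unfolding lp_bounded_operator_def by blast
    ultimately have "cmod D \<le> C * lp_norm p ?t"
      using norm_le_lp_norm[OF p, of "T ?t" m] C[OF t(1)] by auto
    also have "\<dots> \<le> max C 0 * e" using t(2) lp_norm_nonneg[of p ?t] by (intro mult_mono) auto
    finally show ?thesis .
  qed
  have "cmod D \<le> 0"
  proof (rule field_le_epsilon)
    fix e :: real assume e: "e > 0"
    have "max C 0 * (e / (max C 0 + 1)) \<le> e" using e by (simp add: field_simps)
    then show "cmod D \<le> 0 + e" using le[of "e / (max C 0 + 1)"] e by (simp add: add_nonneg_pos)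
  qed
  then show ?thesis by (simp add: D_def)
qed

theorem theorem4p3:
  fixes p :: real
    and w :: "nat \<Rightarrow> real"
    and T :: "(int \<Rightarrow> complex) \<Rightarrow> int \<Rightarrow> complex"
    and m\<^sub>0 :: nat
  assumes "1 < p"
    and "\<And>n. n \<ge> 1 \<Longrightarrow> w n > 0"
    and "lp_bounded_operator p T"
    and "T (lp_basis 0) = lp_basis 1"
    and "\<And>n. n \<ge> 1 \<Longrightarrow>
           T (lp_basis (int n)) = (\<lambda>k. complex_of_real (w n) * lp_basis (int n + 1) k)"
    and "\<And>n. n \<ge> 1 \<Longrightarrow>
           T (lp_basis (- int n)) = (\<lambda>k. complex_of_real (w n) * lp_basis (- int n + 1) k)"
    and "m\<^sub>0 \<ge> 1"
    and "\<And>n. n \<ge> 1 \<Longrightarrow>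
           1 / (real n + 2 * real m\<^sub>0) \<le> w (n + m\<^sub>0) \<and> w (n + m\<^sub>0) \<le> 1 / real n"
  shows "power_set p T = ereal ` {1/2..1}"
proof -
  define a where "a j = (if j = 0 then 1 else w (nat \<bar>j\<bar>))" for j :: int
  have a_pos: "a j > 0" for j using assms(2)[of "nat \<bar>j\<bar>"] by (auto simp: a_def)
  have T_basis: "T (lp_basis j) = (\<lambda>k. of_real (a j) * lp_basis (j + 1) k)" for j
  proof -
    consider "j = 0" | "j > 0" | "j < 0" by linarith
    then show ?thesis
      using assms(4) assms(5)[of "nat j"] assms(6)[of "nat (- j)"] by cases (auto simp: a_def)
  qed
  have "(\<lambda>n. real n * w n) \<longlonglongrightarrow> 1"
  proof (rule LIMSEQ_offset[of _ m\<^sub>0], rule real_tendsto_sandwich)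
    show "(\<lambda>n. real (n + m\<^sub>0) / (real n + 2 * real m\<^sub>0)) \<longlonglongrightarrow> 1"
      "(\<lambda>n. real (n + m\<^sub>0) / real n) \<longlonglongrightarrow> 1" by real_asymp+
    show "\<forall>\<^sub>F n in sequentially. real (n + m\<^sub>0) / (real n + 2 * real m\<^sub>0) \<le> real (n + m\<^sub>0) * w (n + m\<^sub>0)"
      using eventually_ge_at_top[of 1]
    proof eventually_elim
      case (elim n)
      show ?case using mult_left_mono[OF assms(8)[OF elim, THEN conjunct1], of "real (n + m\<^sub>0)"] by simp
    qed
    show "\<forall>\<^sub>F n in sequentially. real (n + m\<^sub>0) * w (n + m\<^sub>0) \<le> real (n + m\<^sub>0) / real n"
      using eventually_ge_at_top[of 1]
    proof eventually_elim
      case (elim n)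
      show ?case using mult_left_mono[OF assms(8)[OF elim, THEN conjunct2], of "real (n + m\<^sub>0)"] by simp
    qed
  qed
  moreover have "(\<lambda>n. real n * a (int n)) = (\<lambda>n. real n * w n)"
    "(\<lambda>n. real n * a (- int n)) = (\<lambda>n. real n * w n)"
    by (auto simp: a_def fun_eq_iff)
  ultimately have lim: "(\<lambda>n. real n * a (int n)) \<longlonglongrightarrow> 1" "(\<lambda>n. real n * a (- int n)) \<longlonglongrightarrow> 1"
    by simp_all
  have p: "p > 0" using assms(1) by simp
  interpret reciprocal_shift a p T
  proof
    fix x assume x: "x \<in> lp p"
    show "T x = (\<lambda>m. of_real (a (m - 1)) * x (m - 1))"
    proof
      fix m
      have "T x m = (\<Sum>j\<in>{m - 1}. x j * T (lp_basis j) m)"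
      proof (rule bounded_operator_coordinate[OF assms(3) p x])
        show "T (lp_basis j) m = 0" if "j \<notin> {m - 1}" for j
          unfolding T_basis using that by (auto simp: lp_basis_def)
      qed simp
      then show "T x m = of_real (a (m - 1)) * x (m - 1)"
        unfolding T_basis by (simp add: lp_basis_def)
    qed
  qed (use a_pos lim assms(1) in auto)
  show ?thesis by (rule power_set_eq)
qed

end
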